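(* For every dimension $n\ge 1$ there exists a constant $c$ depending only on $n$ such that for all weights $u\in A_1$ and $v\in A_1$ on $\mathbb{R}^n$ and all $f\in L^1(uv)$, $$\left\| \frac{M_d (fv)}{v} \right\|_{L^{1, \infty}(uv)} \le c\, [u]_{A_1}^2\,[v]_{A_1}^4\,\|f\|_{L^1(uv)}.$$
   Context: A weight is a nonnegative locally integrable function on $\mathbb{R}^n$. Cubes have sides parallel to the coordinate axes. For a weight $w$, $[w]_{A_1}=\sup_Q\left(\frac1{|Q|}\int_Q w\right)(\operatorname{ess\,inf}_Q w)^{-1}$, the supremum over all cubes $Q\subset\mathbb{R}^n$, and $w\in A_1$ means $[w]_{A_1}<\infty$. $M_d$ is the dyadic maximal operator, $M_d h(x)=\sup_{Q\ni x}\frac1{|Q|}\int_Q|h|$, the supremum over all dyadic cubes $Q$ containing $x$. For a weight $w$, $\|f\|_{L^1(w)}=\int_{\mathbb{R}^n}|f|\,w\,dx$ and $\|F\|_{L^{1,\infty}(w)}=\sup_{t>0} t\, w(\{x:|F(x)|>t\})$, where $w(E)=\int_E w\,dx$. *)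

theory Defs
  imports "HOL-Analysis.Analysis"
begin

text \<open>
  All quantities that may be infinite (averages, suprema, norms) take values in
  \<^typ>\<open>ennreal\<close>, where \<open>0 * \<infinity> = 0\<close> and \<open>a / 0 = \<infinity>\<close> for \<open>a > 0\<close>.
\<close>

definition weight :: "(real^'n \<Rightarrow> real) \<Rightarrow> bool" where
  "weight w \<longleftrightarrow> (\<forall>x. 0 \<le> w x) \<and> (\<forall>K. compact K \<longrightarrow> set_integrable lebesgue K w)"

definition cubes :: "(real^'n) set set" where
  "cubes = {cbox a (\<chi> i. a $ i + l) | a l. 0 < l}"

definition dyadic_cubes :: "(real^'n) set set" where
  "dyadic_cubes =
     {{x. \<forall>i. of_int (m $ i) * 2 powi k \<le> x $ i \<and> x $ i < (of_int (m $ i) + 1) * 2 powi k}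
       | (m :: int^'n) (k :: int). True}"

definition average :: "(real^'n) set \<Rightarrow> (real^'n \<Rightarrow> real) \<Rightarrow> ennreal" where
  "average Q h = (\<integral>\<^sup>+x\<in>Q. ennreal \<bar>h x\<bar> \<partial>lebesgue) / emeasure lebesgue Q"

text \<open>The supremum of the essential lower bounds; only used for nonnegative \<open>w\<close>.\<close>

definition ess_inf_on :: "(real^'n) set \<Rightarrow> (real^'n \<Rightarrow> real) \<Rightarrow> ennreal" where
  "ess_inf_on Q w = Sup {c. AE x in lebesgue. x \<in> Q \<longrightarrow> c \<le> ennreal (w x)}"

text \<open>
  If \<open>w\<close> vanishes almost everywhere on \<open>Q\<close>, then \<open>Q\<close> contributes \<open>0 * \<infinity> = 0\<close>. A weight that
  vanishes on some cube but not almost everywhere still has \<open>A1_const w = \<infinity>\<close>, because of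
  the larger cubes, so the convention only matters for the zero weight.
\<close>

definition A1_const :: "(real^'n \<Rightarrow> real) \<Rightarrow> ennreal" where
  "A1_const w = (SUP Q\<in>cubes. average Q w * inverse (ess_inf_on Q w))"

definition A1 :: "(real^'n \<Rightarrow> real) set" where
  "A1 = {w. weight w \<and> A1_const w < \<infinity>}"

definition dyadic_maximal :: "(real^'n \<Rightarrow> real) \<Rightarrow> real^'n \<Rightarrow> ennreal" where
  "dyadic_maximal h x = (SUP Q\<in>{Q \<in> dyadic_cubes. x \<in> Q}. average Q h)"

text \<open>In the following three definitions \<open>w\<close> is nonnegative, but need not be locally integrable.\<close>

definition L1_norm :: "(real^'n \<Rightarrow> real) \<Rightarrow> (real^'n \<Rightarrow> real) \<Rightarrow> ennreal" where
  "L1_norm w f = (\<integral>\<^sup>+x. ennreal (\<bar>f x\<bar> * w x) \<partial>lebesgue)"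

definition L1_space :: "(real^'n \<Rightarrow> real) \<Rightarrow> (real^'n \<Rightarrow> real) set" where
  "L1_space w = {f. f \<in> borel_measurable lebesgue \<and> L1_norm w f < \<infinity>}"

definition weak_L1_norm :: "(real^'n \<Rightarrow> real) \<Rightarrow> (real^'n \<Rightarrow> ennreal) \<Rightarrow> ennreal" where
  "weak_L1_norm w F =
     (SUP t\<in>{0<..}. ennreal t * (\<integral>\<^sup>+x\<in>{x. F x > ennreal t}. ennreal (w x) \<partial>lebesgue))"

end

theory Submission
  imports Defs
begin

text \<open>
  Let \<open>K\<close> and \<open>L\<close> be the A1 constants of \<open>v\<close> and \<open>u\<close>, and put \<open>h = |f| v / t\<close>.
  Up to null sets, every point \<open>x\<close> of the set to be estimated satisfies
  \<open>b^k < v(x) \<le> b^(k+1)\<close> for some \<open>k\<close> and lies in a maximal dyadic cube \<open>Q\<close> on which the average of \<open>h\<close>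
  exceeds \<open>b^k\<close>; the A1 condition bounds the average of \<open>v\<close> over \<open>Q\<close> by \<open>K v(x)\<close>. Sort these cubes by the
  size \<open>B^(-i)\<close> of that average relative to \<open>b^k\<close>.

  For fixed \<open>i\<close> the averages of \<open>v\<close> at least double along strictly decreasing cubes, so pointwise they sum
  to at most \<open>2 K v\<close>. Applying this to the families where the average of \<open>u\<close> exceeds \<open>s\<close> and integrating
  over \<open>s\<close> gives \<open>\<Sum> b^k u(Q) \<le> C K L \<integral> h u\<close>, uniformly in \<open>i\<close>. As only the part of \<open>Q\<close> where
  \<open>v > b^k\<close> matters, and this part occupies a fraction of order \<open>B^(-i)\<close> of \<open>Q\<close>, the A1 condition for \<open>u\<close>
  improves the \<open>i\<close>-th estimate by a factor \<open>\<theta>^i\<close> (up to \<open>O(K)\<close> initial indices) with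
  \<open>1 - \<theta> = 1/(2L)\<close>. Summing over \<open>i\<close> gives the constant \<open>C K L (K + L)\<close>, which is \<open>O(K^2 L^2)\<close>.
\<close>

section \<open>Dyadic cubes\<close>

text \<open>A cube is named by its scale and any of its points. For a fixed point the cubes through
  it are then a chain indexed by \<open>k\<close>.\<close>

definition dyadic_cube :: "int \<Rightarrow> real^'n \<Rightarrow> (real^'n) set" where
  "dyadic_cube k x = {y. \<forall>i. \<lfloor>y $ i / 2 powi k\<rfloor> = \<lfloor>x $ i / 2 powi k\<rfloor>}"

lemma dyadic_cubes_eq: "dyadic_cubes = {dyadic_cube k x | k x. True}"
proof -
  have eq: "{x. \<forall>i. of_int (m $ i) * 2 powi k \<le> x $ i \<and> x $ i < (of_int (m $ i) + 1) * 2 powi k}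
      = dyadic_cube k (\<chi> i. of_int (m $ i) * 2 powi k)" for m :: "int^'n" and k :: int
    by (simp add: dyadic_cube_def floor_eq_iff pos_le_divide_eq pos_divide_less_eq)
  have eq2: "dyadic_cube k x = {y. \<forall>i. of_int ((\<chi> i. \<lfloor>x $ i / 2 powi k\<rfloor>) $ i) * 2 powi k \<le> y $ i
      \<and> y $ i < (of_int ((\<chi> i. \<lfloor>x $ i / 2 powi k\<rfloor>) $ i) + 1) * 2 powi k}" for x :: "real^'n" and k :: int
    by (simp add: dyadic_cube_def floor_eq_iff pos_le_divide_eq pos_divide_less_eq)
  show ?thesis
  proof (intro equalityI subsetI)
    fix Q :: "(real^'n) set" assume "Q \<in> dyadic_cubes"
    then obtain m k where "Q = {x. \<forall>i. of_int (m $ i) * 2 powi k \<le> x $ i \<and> x $ i < (of_int (m $ i) + 1) * 2 powi k}"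
      unfolding dyadic_cubes_def by blast
    thus "Q \<in> {dyadic_cube k x | k x. True}" unfolding eq by blast
  next
    fix Q :: "(real^'n) set" assume "Q \<in> {dyadic_cube k x | k x. True}"
    then obtain k x where "Q = dyadic_cube k x" by auto
    thus "Q \<in> dyadic_cubes" unfolding dyadic_cubes_def eq2 by blast
  qed
qed

lemma dyadic_cube_in [simp]: "dyadic_cube k x \<in> dyadic_cubes"
  by (auto simp: dyadic_cubes_eq)

lemma mem_dyadic_cube [simp]: "x \<in> dyadic_cube k x"
  by (simp add: dyadic_cube_def)

lemma dyadic_cube_eq: "y \<in> dyadic_cube k x \<Longrightarrow> dyadic_cube k y = dyadic_cube k x"
  by (auto simp: dyadic_cube_def)

lemma dyadic_cubesE:
  assumes "Q \<in> dyadic_cubes" "x \<in> Q"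
  obtains k where "Q = dyadic_cube k x"
proof -
  obtain k z where "Q = dyadic_cube k z" using assms by (auto simp: dyadic_cubes_eq)
  thus ?thesis using that[of k] dyadic_cube_eq[of x k z] assms by simp
qed

text \<open>The integer part at the coarser scale is the integer quotient by a power of two of the
  one at the finer scale, so points that agree at scale \<open>k\<close> agree at every larger
  scale.\<close>

lemma dyadic_cube_mono: "k \<le> l \<Longrightarrow> dyadic_cube k x \<subseteq> dyadic_cube l x"
proof -
  assume "k \<le> l"
  define d where "d = nat (l - k)"
  have l: "l = k + int d" using \<open>k \<le> l\<close> by (simp add: d_def)
  have "\<lfloor>z / 2 powi l\<rfloor> = \<lfloor>z / 2 powi k\<rfloor> div 2 ^ d" for z :: real
  proof -
    have "z / 2 powi l = (z / 2 powi k) / real_of_int (2 ^ d)"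
      by (simp add: l power_int_add)
    thus ?thesis using floor_divide_real_eq_div[of "2 ^ d" "z / 2 powi k"] by (simp only: zero_le_power zero_le_numeral)
  qed
  thus ?thesis by (auto simp: dyadic_cube_def)
qed

lemma dyadic_cubes_nested:
  assumes "P \<in> dyadic_cubes" "Q \<in> dyadic_cubes" "x \<in> P" "x \<in> Q"
  shows "P \<subseteq> Q \<or> Q \<subseteq> P"
proof -
  obtain k l where "P = dyadic_cube k x" "Q = dyadic_cube l x"
    using assms by (meson dyadic_cubesE)
  thus ?thesis using dyadic_cube_mono[of k l x] dyadic_cube_mono[of l k x]
    by (metis linear)
qed

text \<open>The half-open cube is squeezed between an open and a closed box of the same side. This
  yields its volume, and a closed cube to which the A1 condition applies.\<close>

lemma dyadic_cube_bounds:
  fixes x :: "real^'n" and k :: int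
  defines "a \<equiv> (\<chi> i. of_int \<lfloor>x $ i / 2 powi k\<rfloor> * 2 powi k) :: real^'n"
  shows "box a (\<chi> i. a $ i + 2 powi k) \<subseteq> dyadic_cube k x"
    "dyadic_cube k x \<subseteq> cbox a (\<chi> i. a $ i + 2 powi k)"
proof -
  show "box a (\<chi> i. a $ i + 2 powi k) \<subseteq> dyadic_cube k x"
    by (auto simp: a_def dyadic_cube_def floor_eq_iff pos_le_divide_eq pos_divide_less_eq mem_box_cart
        distrib_right less_imp_le)
  show "dyadic_cube k x \<subseteq> cbox a (\<chi> i. a $ i + 2 powi k)"
    by (auto simp: a_def dyadic_cube_def floor_eq_iff pos_le_divide_eq pos_divide_less_eq mem_box_cart
        distrib_right less_imp_le)
qed

lemma sets_dyadic_cube: "dyadic_cube k x \<in> sets borel"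
proof -
  have "dyadic_cube k x = {y \<in> space borel. \<forall>i. \<lfloor>y $ i / 2 powi k\<rfloor> = \<lfloor>x $ i / 2 powi k\<rfloor>}"
    by (simp add: dyadic_cube_def)
  also have "\<dots> \<in> sets borel" by measurable
  finally show ?thesis .
qed

lemma sets_dyadic [measurable, simp]: "Q \<in> dyadic_cubes \<Longrightarrow> Q \<in> sets lebesgue"
  using sets_dyadic_cube sets_completionI_sets[of _ lborel] unfolding dyadic_cubes_eq by fastforce

lemma emeasure_cube:
  fixes a :: "real^'n"
  assumes "0 \<le> l"
  shows "emeasure lebesgue (cbox a (\<chi> i. a $ i + l)) = ennreal (l ^ CARD('n))"
    "emeasure lebesgue (box a (\<chi> i. a $ i + l)) = ennreal (l ^ CARD('n))"
proof -
  have ne: "cbox a (\<chi> i. a $ i + l) \<noteq> {}" using assms by (auto simp: interval_ne_empty_cart)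
  have "measure lborel (cbox a (\<chi> i. a $ i + l)) = l ^ CARD('n)"
    using content_cbox_cart[OF ne] by simp
  thus 1: "emeasure lebesgue (cbox a (\<chi> i. a $ i + l)) = ennreal (l ^ CARD('n))"
    by (simp add: emeasure_eq_ennreal_measure[OF emeasure_lborel_cbox_finite[THEN less_imp_neq, unfolded infinity_ennreal_def]])
  have "emeasure lborel (box a (\<chi> i. a $ i + l)) = emeasure lborel (cbox a (\<chi> i. a $ i + l))"
    by (simp add: emeasure_lborel_box_eq emeasure_lborel_cbox_eq)
  thus "emeasure lebesgue (box a (\<chi> i. a $ i + l)) = ennreal (l ^ CARD('n))"
    using 1 by simp
qed

lemma emeasure_dyadic_cube:
  "emeasure lebesgue (dyadic_cube k (x::real^'n)) = ennreal ((2 powi k) ^ CARD('n))"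
  (is "_ = ?m")
proof (rule antisym)
  define a where "a = ((\<chi> i. of_int \<lfloor>x $ i / 2 powi k\<rfloor> * 2 powi k) :: real^'n)"
  have "emeasure lebesgue (dyadic_cube k x) \<le> emeasure lebesgue (cbox a (\<chi> i. a $ i + 2 powi k))"
    using dyadic_cube_bounds(2)[where x=x and k=k] unfolding a_def
    by (intro emeasure_mono) auto
  thus "emeasure lebesgue (dyadic_cube k x) \<le> ?m"
    by (simp add: emeasure_cube del: emeasure_completion)
  have "emeasure lebesgue (box a (\<chi> i. a $ i + 2 powi k)) \<le> emeasure lebesgue (dyadic_cube k x)"
    using dyadic_cube_bounds(1)[where x=x and k=k] sets_dyadic_cube unfolding a_def
    by (intro emeasure_mono) auto
  thus "?m \<le> emeasure lebesgue (dyadic_cube k x)"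
    by (simp add: emeasure_cube del: emeasure_completion)
qed

lemma measure_dyadic_cube: "measure lebesgue (dyadic_cube k (x::real^'n)) = (2 powi k) ^ CARD('n)"
  unfolding measure_def emeasure_dyadic_cube by (rule enn2real_ennreal) simp

lemma measure_dyadic_pos: "Q \<in> dyadic_cubes \<Longrightarrow> 0 < measure lebesgue Q"
  unfolding dyadic_cubes_eq by (clarify, subst measure_dyadic_cube) simp

lemma emeasure_dyadic: "Q \<in> dyadic_cubes \<Longrightarrow> emeasure lebesgue Q = ennreal (measure lebesgue Q)"
  unfolding dyadic_cubes_eq by (clarify, subst measure_dyadic_cube) (rule emeasure_dyadic_cube)

text \<open>Inclusion forces an inequality of volumes, and volume is strictly increasing in the
  scale.\<close>

lemma dyadic_cube_subset_iff:
  fixes x :: "real^'a"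
  shows "dyadic_cube k x \<subseteq> dyadic_cube l x \<longleftrightarrow> k \<le> l"
proof
  assume *: "dyadic_cube k x \<subseteq> dyadic_cube l x"
  have "emeasure lebesgue (dyadic_cube k x) \<le> emeasure lebesgue (dyadic_cube l x)"
    using * by (intro emeasure_mono) auto
  hence le: "((2::real) powi k) ^ CARD('a) \<le> (2 powi l) ^ CARD('a)"
    unfolding emeasure_dyadic_cube by (subst (asm) ennreal_le_iff) simp_all
  show "k \<le> l"
  proof (rule ccontr)
    assume "\<not> k \<le> l"
    hence "(2::real) powi l < 2 powi k" by (intro power_int_strict_increasing) auto
    hence "((2::real) powi l) ^ CARD('a) < (2 powi k) ^ CARD('a)" by (intro power_strict_mono) auto
    thus False using le by simp
  qed
qed (rule dyadic_cube_mono)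

lemma countable_dyadic_cubes: "countable (dyadic_cubes :: (real^'n) set set)"
proof -
  have *: "(dyadic_cubes :: (real^'n) set set) = range (\<lambda>(m :: int^'n, k :: int). {x. \<forall>i. of_int (m $ i) * 2 powi k \<le> x $ i \<and> x $ i < (of_int (m $ i) + 1) * 2 powi k})"
    unfolding dyadic_cubes_def by auto
  show ?thesis unfolding * by (rule countable_image[OF countableI_type])
qed

text \<open>A point of \<open>P\<close> lies in all these cubes, so they are determined by their
  scales, which range over a bounded interval of integers.\<close>

lemma finite_dyadic_between:
  assumes "P \<in> dyadic_cubes" "Q \<in> dyadic_cubes"
  shows "finite {R \<in> dyadic_cubes. P \<subseteq> R \<and> R \<subseteq> Q}"
proof -
  obtain k x where P: "P = dyadic_cube k x" using assms by (auto simp: dyadic_cubes_eq)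
  have *: "\<exists>j. R = dyadic_cube j x" if "R \<in> dyadic_cubes" "x \<in> R" for R
    using that by (meson dyadic_cubesE)
  show ?thesis
  proof (cases "x \<in> Q")
    case True
    then obtain l where Q: "Q = dyadic_cube l x" using * assms by blast
    have "{R \<in> dyadic_cubes. P \<subseteq> R \<and> R \<subseteq> Q} \<subseteq> (\<lambda>j. dyadic_cube j x) ` {k..l}"
    proof clarify
      fix R assume R: "R \<in> dyadic_cubes" "P \<subseteq> R" "R \<subseteq> Q"
      then obtain j where "R = dyadic_cube j x" using * P mem_dyadic_cube by blast
      with R show "R \<in> (\<lambda>j. dyadic_cube j x) ` {k..l}"
        by (auto simp: P Q dyadic_cube_subset_iff)
    qed
    thus ?thesis by (rule finite_subset) simp
  next
    case False
    hence "{R \<in> dyadic_cubes. P \<subseteq> R \<and> R \<subseteq> Q} = {}"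
      using P mem_dyadic_cube[of x k] by blast
    thus ?thesis by (metis finite.emptyI)
  qed
qed

text \<open>In the stopping argument the next larger cube violates the stopping condition; it is
  compared with \<open>P\<close> at the price of the volume ratio stated here.\<close>

lemma dyadic_parent:
  assumes "P \<in> dyadic_cubes" "Q \<in> dyadic_cubes" "P \<subset> (Q :: (real^'n) set)"
  obtains R where "R \<in> dyadic_cubes" "P \<subset> R" "R \<subseteq> Q"
    "emeasure lebesgue R = 2 ^ CARD('n) * emeasure lebesgue P"
proof -
  obtain k x where P: "P = dyadic_cube k x" using assms by (auto simp: dyadic_cubes_eq)
  have "x \<in> Q" using P assms mem_dyadic_cube[of x k] by auto
  then obtain l where Q: "Q = dyadic_cube l x"
    using dyadic_cubesE[OF _ \<open>x \<in> Q\<close>] assms by blast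
  have "k < l" using assms P Q dyadic_cube_mono[of l k x] by (meson not_less order.strict_iff_not)
  show ?thesis
  proof
    show "dyadic_cube (k+1) x \<in> dyadic_cubes" by simp
    show "P \<subset> dyadic_cube (k+1) x" "dyadic_cube (k+1) x \<subseteq> Q"
      using \<open>k < l\<close> unfolding P Q less_le_not_le dyadic_cube_subset_iff by auto
    show "emeasure lebesgue (dyadic_cube (k+1) x) = 2 ^ CARD('n) * emeasure lebesgue P"
    proof -
      have "((2::real) powi (k+1)) ^ CARD('n) = 2 ^ CARD('n) * (2 powi k) ^ CARD('n)"
        by (simp add: power_int_add power_mult_distrib)
      thus ?thesis unfolding P emeasure_dyadic_cube by (simp add: ennreal_mult flip: ennreal_power)
    qed
  qed
qed

lemma dyadic_in_open:
  assumes "open S" "x \<in> S" "Q \<in> dyadic_cubes" "x \<in> (Q :: (real^'n) set)"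
  obtains P where "P \<in> dyadic_cubes" "x \<in> P" "P \<subseteq> S \<inter> Q"
proof -
  obtain e where e: "0 < e" "ball x e \<subseteq> S" using assms openE by blast
  obtain l where Q: "Q = dyadic_cube l x"
    using dyadic_cubesE[OF _ \<open>x \<in> Q\<close>] assms by blast
  obtain N where N: "(1/2 :: real) ^ N < e / CARD('n)"
    using real_arch_pow_inv[of "e / CARD('n)" "1/2"] e by auto
  \<comment> \<open>The second argument makes the cube so small that
    \<open>CARD('n) * 2 powi k\<close>, which bounds the distance to \<open>x\<close> through the l1
    norm, is below \<open>e\<close>; the minimum with \<open>l\<close> keeps the cube inside
    \<open>Q\<close>.\<close>
  define k where "k = min l (- int N)"
  have "(2::real) powi k \<le> 2 powi (- int N)"
    by (rule power_int_increasing) (auto simp: k_def)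
  also have "\<dots> = (1/2) ^ N" by (simp add: power_int_minus power_one_over inverse_eq_divide)
  finally have "2 powi k < e / CARD('n)" using N by simp
  hence k: "CARD('n) * 2 powi k < e" by (simp add: pos_less_divide_eq mult.commute)
  have "dyadic_cube k x \<subseteq> ball x e"
  proof
    fix y assume "y \<in> dyadic_cube k x"
    hence *: "\<lfloor>y $ i / 2 powi k\<rfloor> = \<lfloor>x $ i / 2 powi k\<rfloor>" for i by (auto simp: dyadic_cube_def)
    have "\<bar>y $ i / 2 powi k - x $ i / 2 powi k\<bar> < 1" for i
      using *[of i] by linarith
    hence "\<bar>(x - y) $ i\<bar> \<le> 2 powi k" for i
      using \<open>\<And>i. \<bar>y $ i / 2 powi k - x $ i / 2 powi k\<bar> < 1\<close>[of i]
      by (simp add: diff_divide_distrib[symmetric] abs_divide field_simps abs_minus_commute less_imp_le)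
    hence "(\<Sum>i\<in>UNIV. \<bar>(x - y) $ i\<bar>) \<le> CARD('n) * 2 powi k"
      using sum_bounded_above[of UNIV "\<lambda>i. \<bar>(x - y) $ i\<bar>" "2 powi k"] by simp
    hence "norm (x - y) < e" using norm_le_l1_cart[of "x - y"] k by linarith
    thus "y \<in> ball x e" by (simp add: dist_norm)
  qed
  moreover have "dyadic_cube k x \<subseteq> Q" unfolding Q by (rule dyadic_cube_mono) (simp add: k_def)
  ultimately show ?thesis using that[of "dyadic_cube k x"] e by auto
qed

section \<open>Maximal members of a family of cubes\<close>

definition maximal_sets :: "'a set set \<Rightarrow> 'a set set" where
  "maximal_sets S = {Q \<in> S. \<forall>R\<in>S. Q \<subseteq> R \<longrightarrow> R = Q}"

lemma maximal_sets_subset: "maximal_sets S \<subseteq> S"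
  by (auto simp: maximal_sets_def)

lemma disjoint_maximal_sets:
  assumes "S \<subseteq> dyadic_cubes"
  shows "disjoint_family_on (\<lambda>Q. Q) (maximal_sets S)"
  unfolding disjoint_family_on_def
proof (intro ballI impI, rule ccontr)
  fix P Q assume *: "P \<in> maximal_sets S" "Q \<in> maximal_sets S" "P \<noteq> Q" "P \<inter> Q \<noteq> {}"
  then obtain x where "x \<in> P" "x \<in> Q" by blast
  moreover have PQ: "P \<in> S" "Q \<in> S" using * by (auto simp: maximal_sets_def)
  ultimately have "P \<subseteq> Q \<or> Q \<subseteq> P" using assms dyadic_cubes_nested[of P Q x] by blast
  thus False using * PQ unfolding maximal_sets_def by blast
qed

lemma ex_maximal_set:
  assumes "finite {R \<in> S. Q \<subseteq> R}" "Q \<in> S"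
  obtains R where "R \<in> maximal_sets S" "Q \<subseteq> R"
proof -
  have "\<exists>R\<in>{R \<in> S. Q \<subseteq> R}. Q \<subseteq> R \<and> (\<forall>P\<in>{R \<in> S. Q \<subseteq> R}. R \<subseteq> P \<longrightarrow> R = P)"
    by (rule finite_has_maximal2) (use assms in auto)
  then obtain R where R: "R \<in> S" "Q \<subseteq> R" "\<And>P. P \<in> S \<Longrightarrow> Q \<subseteq> P \<Longrightarrow> R \<subseteq> P \<Longrightarrow> R = P"
    by auto
  have "R \<in> maximal_sets S"
    unfolding maximal_sets_def using R(1) R(3)[OF _ order_trans[OF R(2)]] by auto
  thus ?thesis using that R(2) by blast
qed

lemma Union_maximal_sets:
  assumes "\<And>Q. Q \<in> S \<Longrightarrow> finite {R \<in> S. Q \<subseteq> R}"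
  shows "\<Union>(maximal_sets S) = \<Union>S"
proof (intro equalityI subsetI)
  fix x assume "x \<in> \<Union>S"
  then obtain Q where "x \<in> Q" "Q \<in> S" by blast
  moreover obtain R where "R \<in> maximal_sets S" "Q \<subseteq> R"
    using ex_maximal_set[OF assms] \<open>Q \<in> S\<close> by blast
  ultimately show "x \<in> \<Union>(maximal_sets S)" by blast
next
  fix x assume "x \<in> \<Union>(maximal_sets S)"
  thus "x \<in> \<Union>S" using maximal_sets_subset[of S] by blast
qed

section \<open>A1 weights on dyadic cubes\<close>

text \<open>Local integrability gives measurability of the truncations to balls, and these converge
  pointwise to \<open>w\<close>.\<close>

lemma weight_measurable:
  assumes "weight w"
  shows "w \<in> borel_measurable lebesgue"
proof (rule borel_measurable_LIMSEQ_real)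
  show "(\<lambda>i. indicator (cball 0 (real i)) x * w x) \<longlonglongrightarrow> w x" for x
  proof (rule tendsto_eventually)
    obtain N where "norm x \<le> real N" using real_arch_simple by blast
    thus "\<forall>\<^sub>F i in sequentially. indicator (cball 0 (real i)) x * w x = w x"
      by (intro eventually_sequentiallyI[of N]) (auto simp: indicator_def)
  qed
  show "(\<lambda>x. indicator (cball 0 (real i)) x * w x) \<in> borel_measurable lebesgue" for i
    using assms borel_measurable_integrable[of lebesgue "\<lambda>x. indicator (cball 0 (real i)) x * w x"]
    by (auto simp: weight_def set_integrable_def)
qed

lemma emeasure_weight:
  assumes "weight w" "S \<in> sets lebesgue"
  shows "(\<integral>\<^sup>+x\<in>S. ennreal \<bar>w x\<bar> \<partial>lebesgue) = emeasure (density lebesgue (\<lambda>x. ennreal (w x))) S"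
  using assms weight_measurable[OF assms(1)] by (simp add: emeasure_density weight_def)

text \<open>The supremum runs over uncountably many lower bounds, but a sequence of them already
  attains it, so only countably many null sets have to be united.\<close>

lemma AE_ess_inf_on: "AE x in lebesgue. x \<in> Q \<longrightarrow> ess_inf_on Q w \<le> ennreal (w x)"
proof -
  define S where "S = {c. AE x in lebesgue. x \<in> Q \<longrightarrow> c \<le> ennreal (w x)}"
  have "0 \<in> S" by (auto simp: S_def)
  then obtain c where c: "range c \<subseteq> S" "Sup S = (SUP i::nat. c i)"
    using ennreal_Sup_countable_SUP[of S] by blast
  have "AE x in lebesgue. \<forall>i. x \<in> Q \<longrightarrow> c i \<le> ennreal (w x)"
    using c(1) by (subst AE_all_countable) (auto simp: S_def)
  thus ?thesis unfolding ess_inf_on_def S_def[symmetric] c(2)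
    by eventually_elim (auto intro: SUP_least)
qed

lemma A1_cube:
  assumes "w \<in> A1" "C \<in> cubes"
  shows "AE x in lebesgue. x \<in> C \<longrightarrow> average C w \<le> A1_const w * ennreal (w x)"
  using AE_ess_inf_on[of C w]
proof eventually_elim
  case (elim x)
  have le: "average C w * inverse (ess_inf_on C w) \<le> A1_const w"
    unfolding A1_const_def using assms(2) by (rule SUP_upper)
  show ?case
  proof
    assume "x \<in> C"
    hence e: "ess_inf_on C w \<le> ennreal (w x)" using elim by blast
    show "average C w \<le> A1_const w * ennreal (w x)"
    proof (cases "ess_inf_on C w = 0")
      case True
      \<comment> \<open>Here the inverse is infinite, so a finite constant is only possible if the
        average is zero.\<close>
      have "average C w * top \<le> A1_const w" using le True by simp
      moreover have "A1_const w < top" using assms by (auto simp: A1_def)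
      ultimately have "average C w = 0" by (auto simp: ennreal_mult_top split: if_splits)
      thus ?thesis by simp
    next
      case False
      have "ess_inf_on C w \<noteq> top" using e by (auto simp: top_unique)
      hence "average C w = average C w * inverse (ess_inf_on C w) * ess_inf_on C w"
        using False by (simp add: less_top ennreal_divide_times flip: divide_ennreal_def)
      also have "\<dots> \<le> A1_const w * ennreal (w x)" using le e by (intro mult_mono) auto
      finally show ?thesis .
    qed
  qed
qed

lemma dyadic_cube_hull:
  assumes "Q \<in> dyadic_cubes"
  obtains C where "C \<in> cubes" "Q \<subseteq> C" "emeasure lebesgue C = emeasure lebesgue Q"
proof -
  obtain k x where Q: "Q = dyadic_cube k x" using assms by (auto simp: dyadic_cubes_eq)
  show ?thesis
  proof (rule that)
    let ?a = "(\<chi> i. of_int \<lfloor>x $ i / 2 powi k\<rfloor> * 2 powi k) :: real^'a"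
    show "Q \<subseteq> cbox ?a (\<chi> i. ?a $ i + 2 powi k)" unfolding Q by (rule dyadic_cube_bounds)
    show "cbox ?a (\<chi> i. ?a $ i + 2 powi k) \<in> cubes" unfolding cubes_def
      by (intro CollectI exI[of _ ?a] exI[of _ "2 powi k"]) auto
    show "emeasure lebesgue (cbox ?a (\<chi> i. ?a $ i + 2 powi k)) = emeasure lebesgue Q"
      unfolding Q emeasure_dyadic_cube by (rule emeasure_cube) simp
  qed
qed

lemma cube_facts:
  assumes "C \<in> cubes"
  shows "compact C" "emeasure lebesgue C \<noteq> 0" "emeasure lebesgue C \<noteq> top"
proof -
  obtain a l where C: "C = cbox a (\<chi> i. a $ i + l)" "0 < l" using assms by (auto simp: cubes_def)
  show "compact C" unfolding C by (rule compact_cbox)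
  have "emeasure lebesgue C = ennreal (l ^ CARD('a))"
    unfolding C(1) using C(2) by (intro emeasure_cube) auto
  thus "emeasure lebesgue C \<noteq> 0" "emeasure lebesgue C \<noteq> top" using C(2) by (auto simp del: emeasure_completion)
qed

lemma weight_compact_finite:
  assumes "weight w" "compact C"
  shows "emeasure (density lebesgue (\<lambda>x. ennreal (w x))) C < \<infinity>"
proof -
  have "integrable lebesgue (\<lambda>x. indicator C x * w x)"
    using assms by (auto simp: weight_def set_integrable_def)
  hence "(\<integral>\<^sup>+x. ennreal (norm (indicator C x * w x)) \<partial>lebesgue) < \<infinity>"
    by (simp add: integrable_iff_bounded)
  also have "(\<integral>\<^sup>+x. ennreal (norm (indicator C x * w x)) \<partial>lebesgue) = (\<integral>\<^sup>+x. ennreal (w x) * indicator C x \<partial>lebesgue)"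
    using assms by (intro nn_integral_cong) (auto simp: indicator_def weight_def)
  also have "\<dots> = emeasure (density lebesgue (\<lambda>x. ennreal (w x))) C"
    using weight_measurable[OF assms(1)] assms(2)
    by (subst emeasure_density) (auto intro!: borel_compact simp: sets_completionI_sets)
  finally show ?thesis .
qed

text \<open>Integrating the A1 inequality over a cube of positive finite mass and cancelling that
  mass gives the bound. Such a cube exists because countably many dyadic unit cubes cover the space.
  For the zero weight the constant is 0, whence the second hypothesis.\<close>

lemma A1_ge_1:
  assumes "w \<in> A1" "\<not> (AE x in lebesgue. w x = 0)"
  shows "1 \<le> A1_const w"
proof -
  have w: "weight w" using assms by (auto simp: A1_def)
  note [measurable] = weight_measurable[OF w]
  have "\<exists>C\<in>cubes. emeasure (density lebesgue (\<lambda>x. ennreal (w x))) C \<noteq> 0"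
  proof (rule ccontr)
    assume *: "\<not> ?thesis"
    have "AE x in lebesgue. x \<in> dyadic_cube 0 z \<longrightarrow> w x = 0" for z
    proof -
      obtain C where C: "C \<in> cubes" "dyadic_cube 0 z \<subseteq> C"
        using dyadic_cube_hull[OF dyadic_cube_in] by blast
      hence "emeasure (density lebesgue (\<lambda>x. ennreal (w x))) C = 0" using * by blast
      moreover have "C \<in> sets lebesgue"
        using cube_facts(1)[OF C(1)] by (intro sets_completionI_sets) (auto intro: borel_compact)
      ultimately have "AE x in lebesgue. ennreal (w x) * indicator C x = 0"
        by (simp add: emeasure_density nn_integral_0_iff_AE)
      thus "AE x in lebesgue. x \<in> dyadic_cube 0 z \<longrightarrow> w x = 0"
        by eventually_elim (use C(2) w in \<open>auto simp: indicator_def weight_def ennreal_eq_0_iff intro: antisym\<close>)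
    qed
    hence "AE x in lebesgue. x \<in> Q \<longrightarrow> w x = 0" if "Q \<in> range (dyadic_cube 0)" for Q
      using that by blast
    moreover have "countable (range (dyadic_cube 0 :: real^'a \<Rightarrow> _))"
      by (rule countable_subset[OF _ countable_dyadic_cubes]) auto
    ultimately have "AE x in lebesgue. \<forall>Q\<in>range (dyadic_cube 0). x \<in> Q \<longrightarrow> w x = 0"
      by (subst AE_ball_countable) auto
    hence "AE x in lebesgue. w x = 0"
      by eventually_elim (use mem_dyadic_cube in blast)
    thus False using assms(2) by blast
  qed
  then obtain C where C: "C \<in> cubes" and ne: "emeasure (density lebesgue (\<lambda>x. ennreal (w x))) C \<noteq> 0" by blast
  define M where "M = emeasure (density lebesgue (\<lambda>x. ennreal (w x))) C"
  have Cs[measurable]: "C \<in> sets lebesgue"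
    using cube_facts(1)[OF C] by (intro sets_completionI_sets) (auto intro: borel_compact)
  have M: "M \<noteq> 0" "M \<noteq> top" using ne weight_compact_finite[OF w cube_facts(1)[OF C]] by (auto simp: M_def)
  have av: "average C w = M / emeasure lebesgue C"
    unfolding average_def emeasure_weight[OF w Cs] M_def ..
  have "M = (M / emeasure lebesgue C) * emeasure lebesgue C"
    using cube_facts(2,3)[OF C] by (simp add: ennreal_divide_times less_top del: emeasure_completion)
  also have "\<dots> = (\<integral>\<^sup>+x. average C w * indicator C x \<partial>lebesgue)"
    unfolding av by (subst nn_integral_cmult_indicator) auto
  also have "\<dots> \<le> (\<integral>\<^sup>+x. A1_const w * (ennreal (w x) * indicator C x) \<partial>lebesgue)"
    using A1_cube[OF assms(1) C] by (intro nn_integral_mono_AE, eventually_elim) (auto simp: indicator_def)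
  also have "\<dots> = A1_const w * M"
    by (simp add: nn_integral_cmult emeasure_density M_def)
  finally have "1 * M \<le> A1_const w * M" by simp
  hence "M * 1 \<le> M * A1_const w" by (simp add: mult.commute)
  thus ?thesis using M ennreal_mult_le_mult_iff by blast
qed

text \<open>Only dyadic cubes and real constants occur from here on. The A1 condition is multiplied
  out, so that neither an essential infimum nor a division is left.\<close>

locale dyadic_A1 =
  fixes w :: "real^'n \<Rightarrow> real" and K :: real
  assumes measurable_w [measurable]: "w \<in> borel_measurable lebesgue"
    and w_nonneg: "0 \<le> w x"
    and finite_w: "Q \<in> dyadic_cubes \<Longrightarrow> emeasure (density lebesgue (\<lambda>x. ennreal (w x))) Q < \<infinity>"
    and K_ge_1: "1 \<le> K"
    and AE_le: "Q \<in> dyadic_cubes \<Longrightarrow> AE x in lebesgue. x \<in> Q \<longrightarrow>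
      measure (density lebesgue (\<lambda>x. ennreal (w x))) Q \<le> K * w x * measure lebesgue Q"
begin

definition W :: "(real^'n) measure" where
  "W = density lebesgue (\<lambda>x. ennreal (w x))"

definition avg :: "(real^'n) set \<Rightarrow> real" where
  "avg Q = measure W Q / measure lebesgue Q"

end

text \<open>The closed hull of a dyadic cube has the same volume and at least the same mass, so the
  A1 condition on the hull passes to the dyadic cube with the same constant.\<close>

lemma A1_imp_dyadic_A1:
  assumes "w \<in> A1" "\<not> (AE x in lebesgue. w x = 0)"
  shows "dyadic_A1 w (enn2real (A1_const w))"
proof
  have w: "weight w" and fin: "A1_const w < top" using assms by (auto simp: A1_def)
  show meas[measurable]: "w \<in> borel_measurable lebesgue" by (rule weight_measurable[OF w])
  show nn: "0 \<le> w x" for x using w by (auto simp: weight_def)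
  let ?W = "density lebesgue (\<lambda>x. ennreal (w x))"
  let ?K = "enn2real (A1_const w)"
  show "1 \<le> ?K" using A1_ge_1[OF assms] fin by (metis enn2real_1 enn2real_mono)
  fix Q :: "(real^'a) set" assume Q: "Q \<in> dyadic_cubes"
  obtain C where C: "C \<in> cubes" "Q \<subseteq> C" "emeasure lebesgue C = emeasure lebesgue Q"
    using dyadic_cube_hull[OF Q] by blast
  have Cs[measurable]: "C \<in> sets lebesgue"
    using cube_facts(1)[OF C(1)] by (intro sets_completionI_sets) (auto intro: borel_compact)
  have le: "emeasure ?W Q \<le> emeasure ?W C" using C by (intro emeasure_mono) auto
  show finQ: "emeasure ?W Q < \<infinity>"
    using le weight_compact_finite[OF w cube_facts(1)[OF C(1)]] by (rule le_less_trans)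
  show "AE x in lebesgue. x \<in> Q \<longrightarrow> measure ?W Q \<le> ?K * w x * measure lebesgue Q"
    using A1_cube[OF assms(1) C(1)]
  proof eventually_elim
    case (elim x)
    show ?case
    proof
      assume "x \<in> Q"
      hence *: "emeasure ?W C / emeasure lebesgue C \<le> A1_const w * ennreal (w x)"
        using elim C(2) unfolding average_def emeasure_weight[OF w Cs] by blast
      have "emeasure ?W C = emeasure ?W C / emeasure lebesgue C * emeasure lebesgue C"
        using cube_facts(2,3)[OF C(1)] by (simp add: ennreal_divide_times less_top del: emeasure_completion)
      also have "\<dots> \<le> A1_const w * ennreal (w x) * emeasure lebesgue C"
        using * by (intro mult_right_mono) auto
      also have "\<dots> = ennreal ?K * ennreal (w x) * ennreal (measure lebesgue Q)"
        unfolding C(3) emeasure_dyadic[OF Q] using fin by simp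
      also have "\<dots> = ennreal (?K * w x * measure lebesgue Q)"
        using nn by (simp add: ennreal_mult)
      finally have "emeasure ?W Q \<le> ennreal (?K * w x * measure lebesgue Q)" using le by simp
      moreover have "emeasure ?W Q = ennreal (measure ?W Q)"
        using finQ by (intro emeasure_eq_ennreal_measure) auto
      ultimately show "measure ?W Q \<le> ?K * w x * measure lebesgue Q"
        using nn[of x] by (simp add: ennreal_le_iff)
    qed
  qed
qed

section \<open>Decay of A1 weights on small sets\<close>

context dyadic_A1
begin

lemma sets_W [simp, measurable_cong]: "sets W = sets lebesgue"
  by (simp add: W_def)

lemma space_W [simp]: "space W = UNIV"
  by (simp add: W_def)

lemma emeasure_W: "S \<in> sets lebesgue \<Longrightarrow> emeasure W S = (\<integral>\<^sup>+x. ennreal (w x) * indicator S x \<partial>lebesgue)"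
  by (simp add: W_def emeasure_density)

lemma measure_W: "Q \<in> dyadic_cubes \<Longrightarrow> S \<subseteq> Q \<Longrightarrow> emeasure W S = ennreal (measure W S)"
proof (rule emeasure_eq_ennreal_measure)
  assume "Q \<in> dyadic_cubes" "S \<subseteq> Q"
  hence "emeasure W S \<le> emeasure W Q" by (intro emeasure_mono) auto
  thus "emeasure W S \<noteq> top" using finite_w[OF \<open>Q \<in> dyadic_cubes\<close>] unfolding W_def[symmetric] by auto
qed

lemma avg_nonneg: "0 \<le> avg Q"
  by (simp add: avg_def)

lemma measure_W_eq_avg: "Q \<in> dyadic_cubes \<Longrightarrow> measure W Q = avg Q * measure lebesgue Q"
  using measure_dyadic_pos[of Q] by (simp add: avg_def)

lemma emeasure_W_eq_avg: "Q \<in> dyadic_cubes \<Longrightarrow> emeasure W Q = ennreal (avg Q) * emeasure lebesgue Q"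
  using measure_dyadic_pos[of Q] measure_W[of Q Q]
  by (simp add: measure_W_eq_avg emeasure_dyadic ennreal_mult avg_nonneg del: emeasure_completion)

text \<open>There are only countably many dyadic cubes, hence one null set serves for all of them:
  the dyadic maximal function of \<open>w\<close> is at most \<open>K * w\<close> almost
  everywhere.\<close>

lemma AE_avg_le: "AE x in lebesgue. \<forall>Q\<in>dyadic_cubes. x \<in> Q \<longrightarrow> avg Q \<le> K * w x"
proof (subst AE_ball_countable[OF countable_dyadic_cubes], intro ballI)
  fix Q :: "(real^'n) set" assume Q: "Q \<in> dyadic_cubes"
  show "AE x in lebesgue. x \<in> Q \<longrightarrow> avg Q \<le> K * w x"
    using AE_le[OF Q] unfolding W_def[symmetric] measure_W_eq_avg[OF Q]
    by eventually_elim (use measure_dyadic_pos[OF Q] in simp)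
qed

definition \<theta> :: real where "\<theta> = 1 - 1 / (2 * K)"

lemma \<theta>_bounds: "0 \<le> \<theta>" "\<theta> < 1"
  using K_ge_1 by (auto simp: \<theta>_def field_simps)

text \<open>Almost everywhere on \<open>Q - A\<close>, at least half of \<open>Q\<close>, the weight
  is no less than \<open>avg Q / K\<close>. Thus \<open>Q - A\<close> carries at least the fraction
  \<open>1 / (2 * K)\<close> of the mass, and \<open>\<theta>\<close> is what remains for
  \<open>A\<close>.\<close>

lemma half_measure:
  assumes Q: "Q \<in> dyadic_cubes" and A: "A \<in> sets lebesgue" "A \<subseteq> Q"
    and le: "2 * emeasure lebesgue A \<le> emeasure lebesgue Q"
  shows "emeasure W A \<le> ennreal \<theta> * emeasure W Q"
proof -
  note [measurable] = A(1) sets_dyadic[OF Q]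
  have Qf: "Q \<in> fmeasurable lebesgue" using Q by (intro fmeasurableI) (auto simp: emeasure_dyadic simp del: emeasure_completion)
  have Af: "A \<in> fmeasurable lebesgue" by (rule fmeasurableI2[OF Qf A(2) A(1)])
  have le': "2 * measure lebesgue A \<le> measure lebesgue Q"
  proof -
    have "ennreal (2 * measure lebesgue A) \<le> ennreal (measure lebesgue Q)"
      using le emeasure_eq_measure2[OF Af] emeasure_dyadic[OF Q]
      by (simp add: ennreal_mult del: emeasure_completion)
    thus ?thesis by simp
  qed
  have diff: "measure lebesgue (Q - A) = measure lebesgue Q - measure lebesgue A"
    using Qf Af A(2) by (simp add: measure_Diff fmeasurable_def)
  have "ennreal (avg Q / K) * emeasure lebesgue (Q - A) = (\<integral>\<^sup>+x. ennreal (avg Q / K) * indicator (Q - A) x \<partial>lebesgue)"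
    by (subst nn_integral_cmult_indicator) auto
  also have "\<dots> \<le> (\<integral>\<^sup>+x. ennreal (w x) * indicator (Q - A) x \<partial>lebesgue)"
    using AE_avg_le
  proof (intro nn_integral_mono_AE, eventually_elim)
    case (elim x)
    show ?case
    proof (cases "x \<in> Q")
      case True
      hence "avg Q / K \<le> w x" using elim Q K_ge_1 by (auto simp: field_simps)
      thus ?thesis by (intro mult_right_mono ennreal_leI) auto
    qed auto
  qed
  also have "\<dots> = emeasure W (Q - A)" by (rule emeasure_W[symmetric]) auto
  finally have *: "ennreal (avg Q / K) * emeasure lebesgue (Q - A) \<le> emeasure W (Q - A)" .
  have "emeasure lebesgue (Q - A) = ennreal (measure lebesgue (Q - A))"
    using Qf Af by (intro emeasure_eq_measure2) auto
  hence "ennreal (avg Q / K) * ennreal (measure lebesgue (Q - A)) \<le> ennreal (measure W (Q - A))"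
    using * measure_W[OF Q, of "Q - A"] by (simp only: Diff_subset)
  hence "ennreal (avg Q / K * measure lebesgue (Q - A)) \<le> ennreal (measure W (Q - A))"
    using avg_nonneg[of Q] K_ge_1 by (subst ennreal_mult) simp_all
  hence **: "avg Q / K * measure lebesgue (Q - A) \<le> measure W (Q - A)" by simp
  have "measure W (Q - A) = measure W Q - measure W A"
  proof (rule measure_Diff)
    show "emeasure W Q \<noteq> \<infinity>" using measure_W[OF Q, of Q] by simp
  qed (use A in auto)
  moreover have "avg Q / K * (measure lebesgue Q / 2) \<le> avg Q / K * measure lebesgue (Q - A)"
    using le' diff avg_nonneg[of Q] K_ge_1 by (intro mult_left_mono) auto
  moreover have "avg Q / K * (measure lebesgue Q / 2) = measure W Q / (2 * K)"
    by (simp add: measure_W_eq_avg[OF Q])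
  ultimately have "measure W A \<le> \<theta> * measure W Q"
    using ** by (simp add: \<theta>_def left_diff_distrib)
  hence "ennreal (measure W A) \<le> ennreal \<theta> * ennreal (measure W Q)"
    using \<theta>_bounds by (subst ennreal_mult[symmetric]) (auto intro: ennreal_leI)
  thus ?thesis
    by (simp only: measure_W[OF Q A(2)] measure_W[OF Q order_refl])
qed

text \<open>
  Induction over stopping cubes. Each step costs \<open>2 ^ CARD('n)\<close> for passing to dyadic parents and another
  factor \<open>2\<close> for the stopping cubes to fill at most half of \<open>Q\<close>. Openness makes the stopping cubes cover all of \<open>S \<inter> Q\<close>, so that no Lebesgue
  differentiation theorem is needed.
\<close>

lemma decay_open:
  assumes "open S" "Q \<in> dyadic_cubes"
    and "2 ^ (j * (CARD('n) + 1)) * emeasure lebesgue (S \<inter> Q) \<le> emeasure lebesgue Q"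
  shows "emeasure W (S \<inter> Q) \<le> ennreal (\<theta> ^ j) * emeasure W Q"
  using assms(2,3)
proof (induction j arbitrary: Q)
  case 0
  thus ?case by (auto intro!: emeasure_mono)
next
  case (Suc j)
  note Q = Suc.prems(1)
  define B :: ennreal where "B = 2 ^ (j * (CARD('n) + 1))"
  have Bpos: "1 \<le> B" "B < top" by (auto simp: B_def one_le_power power_less_top_ennreal)
  \<comment> \<open>The stopping density is smaller by \<open>2 ^ CARD('n)\<close> than the density
    \<open>1 / B\<close> permitted by the induction hypothesis, which leaves room for passing to a
    parent.\<close>
  define F where "F = {P \<in> dyadic_cubes. P \<subseteq> Q \<and> emeasure lebesgue P < 2 ^ CARD('n) * B * emeasure lebesgue (S \<inter> P)}"
  have [measurable]: "S \<in> sets lebesgue" using assms(1) by (intro sets_completionI_sets) auto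
  have small: "2 * (2 ^ CARD('n) * B * emeasure lebesgue (S \<inter> Q)) \<le> emeasure lebesgue Q"
    using Suc.prems(2) by (simp add: B_def power_add mult_ac)
  have FD: "F \<subseteq> dyadic_cubes" by (auto simp: F_def)
  have fin: "finite {R \<in> F. P \<subseteq> R}" if "P \<in> F" for P
    using that Q by (intro finite_subset[OF _ finite_dyadic_between[of P Q]]) (auto simp: F_def)
  let ?M = "maximal_sets F"
  have MD: "?M \<subseteq> dyadic_cubes" using maximal_sets_subset FD by blast
  have countM: "countable ?M" using MD countable_dyadic_cubes by (rule countable_subset)
  have disj: "disjoint_family_on (\<lambda>P. P) ?M" using FD by (rule disjoint_maximal_sets)
  have MQ: "\<Union>?M \<subseteq> Q" using maximal_sets_subset[of F] by (auto simp: F_def)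
  have [measurable]: "\<Union>?M \<in> sets lebesgue"
    using countM MD by (intro sets.countable_Union) auto
  have cover: "S \<inter> Q \<subseteq> \<Union>?M"
  proof
    fix x assume x: "x \<in> S \<inter> Q"
    then obtain P where P: "P \<in> dyadic_cubes" "x \<in> P" "P \<subseteq> S \<inter> Q"
      using dyadic_in_open[OF assms(1), of x Q] Q by blast
    \<comment> \<open>Since \<open>P\<close> lies in \<open>S\<close>, its density is one. The
      factor in \<open>F\<close> is at least 2 and \<open>P\<close> has finite positive measure, so
      the strict inequality of \<open>F\<close> holds.\<close>
    have "ennreal (measure lebesgue P) < ennreal 2 * ennreal (measure lebesgue P)"
      using measure_dyadic_pos[OF P(1)]
      by (subst ennreal_mult[symmetric]) (auto simp: ennreal_less_iff simp del: ennreal_numeral)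
    hence "emeasure lebesgue P < 2 * emeasure lebesgue P"
      by (simp only: emeasure_dyadic[OF P(1)] ennreal_numeral)
    also have "\<dots> \<le> 2 ^ CARD('n) * B * emeasure lebesgue P"
    proof (intro mult_right_mono)
      have "(2::ennreal) * 1 \<le> 2 ^ CARD('n) * B"
        using Bpos power_increasing[of 1 "CARD('n)" "2::ennreal"]
        by (intro mult_mono) (auto simp: Suc_leI)
      thus "(2::ennreal) \<le> 2 ^ CARD('n) * B" by simp
    qed auto
    finally have "P \<in> F" using P by (auto simp: F_def Int_absorb1)
    thus "x \<in> \<Union>?M" using Union_maximal_sets[of F] fin P(2) by blast
  qed
  \<comment> \<open>Countable additivity over the disjoint stopping cubes, stated for a general
    measure because it serves both \<open>lebesgue\<close> and \<open>W\<close>.\<close>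
  have decomp: "emeasure N (X \<inter> \<Union>?M) = (\<integral>\<^sup>+P. emeasure N (X \<inter> P) \<partial>count_space ?M)"
    if "sets N = sets lebesgue" "X \<in> sets lebesgue" for N X
  proof -
    have eq: "X \<inter> \<Union>?M = (\<Union>P\<in>?M. X \<inter> P)" by auto
    have "X \<inter> P \<in> sets N" if "P \<in> ?M" for P
      using MD that sets.Int[OF \<open>X \<in> sets lebesgue\<close> sets_dyadic[of P]] \<open>sets N = sets lebesgue\<close> by auto
    moreover have "disjoint_family_on (\<lambda>P. X \<inter> P) ?M"
      using disj unfolding disjoint_family_on_def by blast
    ultimately have "emeasure N (\<Union>P\<in>?M. X \<inter> P) = (\<integral>\<^sup>+P. emeasure N (X \<inter> P) \<partial>count_space ?M)"
      by (intro emeasure_UN_countable countM)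
    thus ?thesis by (simp only: eq)
  qed
  have step: "emeasure W (S \<inter> P) \<le> ennreal (\<theta> ^ j) * emeasure W P" if P: "P \<in> ?M" for P
  proof -
    have PF: "P \<in> F" and PD: "P \<in> dyadic_cubes" and PQ: "P \<subseteq> Q"
      using P maximal_sets_subset[of F] by (auto simp: F_def)
    \<comment> \<open>The density of \<open>S\<close> in \<open>Q\<close> is too small for
      \<open>Q\<close> to stop, so every stopping cube has a parent inside \<open>Q\<close>.\<close>
    have "P \<noteq> Q"
    proof
      assume "P = Q"
      hence "emeasure lebesgue Q < 2 ^ CARD('n) * B * emeasure lebesgue (S \<inter> Q)" using PF by (auto simp: F_def)
      also have "\<dots> \<le> 2 * (2 ^ CARD('n) * B * emeasure lebesgue (S \<inter> Q))"
        using mult_right_mono[of 1 "2::ennreal"] by simp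
      finally show False using small by simp
    qed
    then obtain R where R: "R \<in> dyadic_cubes" "P \<subset> R" "R \<subseteq> Q"
        "emeasure lebesgue R = 2 ^ CARD('n) * emeasure lebesgue P"
      using dyadic_parent[OF PD Q] PQ by blast
    \<comment> \<open>By maximality of \<open>P\<close> the parent fails the stopping test; this
      bounds the density of \<open>S\<close> in \<open>R\<close> and hence, up to the volume ratio,
      in \<open>P\<close>.\<close>
    have "R \<notin> F" using R(2) P by (auto simp: maximal_sets_def)
    hence "2 ^ CARD('n) * B * emeasure lebesgue (S \<inter> R) \<le> emeasure lebesgue R"
      using R by (auto simp: F_def)
    moreover have "emeasure lebesgue (S \<inter> P) \<le> emeasure lebesgue (S \<inter> R)"
      using R(1,2) by (intro emeasure_mono) auto
    ultimately have "2 ^ CARD('n) * B * emeasure lebesgue (S \<inter> P) \<le> 2 ^ CARD('n) * emeasure lebesgue P"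
      unfolding R(4)[symmetric] by (meson mult_left_mono order_trans zero_le)
    hence "B * emeasure lebesgue (S \<inter> P) \<le> emeasure lebesgue P"
      unfolding mult.assoc by (subst (asm) ennreal_mult_le_mult_iff) (auto simp: power_eq_top_ennreal)
    thus ?thesis using Suc.IH[OF PD] by (simp add: B_def)
  qed
  have "2 * emeasure lebesgue (\<Union>?M) \<le> emeasure lebesgue Q"
  proof -
    have "emeasure lebesgue (\<Union>?M) = (\<integral>\<^sup>+P. emeasure lebesgue P \<partial>count_space ?M)"
      using decomp[of lebesgue UNIV] by simp
    also have "\<dots> \<le> (\<integral>\<^sup>+P. (2 ^ CARD('n) * B) * emeasure lebesgue (S \<inter> P) \<partial>count_space ?M)"
      using maximal_sets_subset[of F] by (intro nn_integral_mono) (auto simp: F_def less_imp_le)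
    also have "\<dots> = (2 ^ CARD('n) * B) * emeasure lebesgue (S \<inter> \<Union>?M)"
      using decomp[of lebesgue S] by (simp add: nn_integral_cmult)
    also have "\<dots> \<le> (2 ^ CARD('n) * B) * emeasure lebesgue (S \<inter> Q)"
      using MQ Q by (intro mult_left_mono emeasure_mono) auto
    finally have "2 * emeasure lebesgue (\<Union>?M) \<le> 2 * (2 ^ CARD('n) * B * emeasure lebesgue (S \<inter> Q))"
      by (intro mult_left_mono) auto
    thus ?thesis using small by (rule order_trans)
  qed
  hence half: "emeasure W (\<Union>?M) \<le> ennreal \<theta> * emeasure W Q"
    using Q MQ by (intro half_measure) auto
  have "emeasure W (S \<inter> Q) \<le> emeasure W (S \<inter> \<Union>?M)"
    using cover by (intro emeasure_mono) auto
  also have "\<dots> = (\<integral>\<^sup>+P. emeasure W (S \<inter> P) \<partial>count_space ?M)"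
    by (rule decomp) auto
  also have "\<dots> \<le> (\<integral>\<^sup>+P. ennreal (\<theta> ^ j) * emeasure W P \<partial>count_space ?M)"
    using step by (intro nn_integral_mono) auto
  also have "\<dots> = ennreal (\<theta> ^ j) * emeasure W (\<Union>?M)"
    using decomp[of W UNIV] by (simp add: nn_integral_cmult)
  also have "\<dots> \<le> ennreal (\<theta> ^ j) * (ennreal \<theta> * emeasure W Q)"
    using half by (rule mult_left_mono) simp
  also have "\<dots> = ennreal (\<theta> ^ Suc j) * emeasure W Q"
    using \<theta>_bounds by (simp add: ennreal_mult mult_ac)
  finally show ?case .
qed

text \<open>Outer approximation by an open set reduces this to \<open>decay_open\<close>. The extra
  factor 2 in the hypothesis splits the permitted measure evenly between \<open>A\<close> and the
  excess of the open set.\<close>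

lemma decay:
  assumes A: "A \<in> sets lebesgue" "A \<subseteq> Q" and Q: "Q \<in> dyadic_cubes"
    and le: "2 * 2 ^ (j * (CARD('n) + 1)) * emeasure lebesgue A \<le> emeasure lebesgue Q"
  shows "emeasure W A \<le> ennreal (\<theta> ^ j) * emeasure W Q"
proof -
  define b :: real where "b = 2 ^ (j * (CARD('n) + 1))"
  have b: "0 < b" "ennreal b = 2 ^ (j * (CARD('n) + 1))" by (auto simp: b_def simp flip: ennreal_power)
  define m where "m = measure lebesgue Q"
  have m: "0 < m" "emeasure lebesgue Q = ennreal m"
    using measure_dyadic_pos[OF Q] emeasure_dyadic[OF Q] by (auto simp: m_def)
  obtain S where S: "open S" "A \<subseteq> S" "S - A \<in> lmeasurable" "emeasure lebesgue (S - A) < ennreal (m / (2 * b))"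
    using sets_lebesgue_outer_open[OF A(1), of "m / (2 * b)"] m b by auto
  have Ss: "S \<in> sets lebesgue" using S(1) by (intro sets_completionI_sets) auto
  have "emeasure lebesgue (S \<inter> Q) \<le> emeasure lebesgue (A \<union> (S - A))"
    using S A Ss by (intro emeasure_mono) auto
  also have "\<dots> = emeasure lebesgue A + emeasure lebesgue (S - A)"
    using S A by (intro plus_emeasure[symmetric]) auto
  also have "\<dots> \<le> emeasure lebesgue A + ennreal (m / (2 * b))"
    using S(4) by (intro add_left_mono less_imp_le)
  finally have "ennreal b * emeasure lebesgue (S \<inter> Q) \<le> ennreal b * (emeasure lebesgue A + ennreal (m / (2 * b)))"
    by (rule mult_left_mono) simp
  also have "\<dots> = ennreal b * emeasure lebesgue A + ennreal (m / 2)"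
  proof -
    have "ennreal b * ennreal (m / (2 * b)) = ennreal (m / 2)"
      using m(1) b(1) by (subst ennreal_mult[symmetric]) auto
    thus ?thesis by (simp only: distrib_left)
  qed
  also have "\<dots> \<le> ennreal (m / 2) + ennreal (m / 2)"
  proof (rule add_right_mono)
    have "2 * (ennreal b * emeasure lebesgue A) \<le> 2 * ennreal (m / 2)"
    proof -
      have "2 * ennreal (m / 2) = ennreal m"
        using m(1) ennreal_mult[of 2 "m / 2"] by simp
      thus ?thesis using le unfolding m(2) b(2) by (simp only: mult.assoc)
    qed
    thus "ennreal b * emeasure lebesgue A \<le> ennreal (m / 2)"
      by (subst (asm) ennreal_mult_le_mult_iff) auto
  qed
  also have "\<dots> = emeasure lebesgue Q"
    unfolding m(2) using m(1) by (subst ennreal_plus[symmetric]) auto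
  finally have "2 ^ (j * (CARD('n) + 1)) * emeasure lebesgue (S \<inter> Q) \<le> emeasure lebesgue Q"
    unfolding b(2) .
  hence "emeasure W (S \<inter> Q) \<le> ennreal (\<theta> ^ j) * emeasure W Q"
    using S(1) Q by (intro decay_open)
  moreover have "emeasure W A \<le> emeasure W (S \<inter> Q)"
    using S A Q Ss by (intro emeasure_mono) auto
  ultimately show ?thesis by (rule order_trans[rotated])
qed

end

section \<open>Carleson packing\<close>

text \<open>Take out a largest value. All others are at most half of it, so by induction their sum
  does not exceed it.\<close>

lemma sum_geometric_le:
  fixes f :: "'a \<Rightarrow> real"
  assumes "finite S" "\<And>a. a \<in> S \<Longrightarrow> 0 \<le> f a" "\<And>a. a \<in> S \<Longrightarrow> f a \<le> B" "0 \<le> B"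
    and "\<And>a b. a \<in> S \<Longrightarrow> b \<in> S \<Longrightarrow> a \<noteq> b \<Longrightarrow> 2 * f a \<le> f b \<or> 2 * f b \<le> f a"
  shows "sum f S \<le> 2 * B"
  using assms
proof (induction S arbitrary: B rule: finite_psubset_induct)
  case (psubset S)
  show ?case
  proof (cases "S = {}")
    case False
    define m where "m = Max (f ` S)"
    have "m \<in> f ` S" unfolding m_def using False psubset.hyps by (intro Max_in) auto
    then obtain a where a: "a \<in> S" "f a = m" by auto
    have le: "f b \<le> f a" if "b \<in> S" for b using that psubset.hyps a by (simp add: m_def)
    have "sum f (S - {a}) \<le> 2 * (f a / 2)"
    proof (rule psubset.IH)
      fix b assume b: "b \<in> S - {a}"
      thus "f b \<le> f a / 2" using psubset.prems(4)[of a b] le[of b] a psubset.prems(1)[of b] by auto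
    qed (use a psubset.prems in auto)
    moreover have "sum f S = f a + sum f (S - {a})" using a psubset.hyps by (simp add: sum.remove)
    ultimately show ?thesis using psubset.prems(2)[OF a(1)] by simp
  qed (use psubset.prems in auto)
qed

text \<open>The maximal cubes of the family have the same union and are disjoint, so the estimates
  on single cubes add up without overlap.\<close>

lemma emeasure_Union_le:
  assumes "finite \<Gamma>" "\<Gamma> \<subseteq> dyadic_cubes" "sets M = sets lebesgue" "sets N = sets lebesgue"
    and "\<And>Q. Q \<in> \<Gamma> \<Longrightarrow> emeasure M Q \<le> c * emeasure N Q"
  shows "emeasure M (\<Union>\<Gamma>) \<le> c * emeasure N (\<Union>\<Gamma>)"
proof -
  have sub: "maximal_sets \<Gamma> \<subseteq> \<Gamma>" by (rule maximal_sets_subset)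
  have fin: "finite (maximal_sets \<Gamma>)" using sub assms(1) by (rule finite_subset)
  have U: "\<Union>(maximal_sets \<Gamma>) = \<Union>\<Gamma>" using assms(1) by (intro Union_maximal_sets) auto
  have eq: "emeasure A (\<Union>\<Gamma>) = (\<Sum>Q\<in>maximal_sets \<Gamma>. emeasure A Q)" if "sets A = sets lebesgue" for A
  proof -
    have "(\<lambda>Q. Q) ` maximal_sets \<Gamma> \<subseteq> sets A" using that sub assms(2) by auto
    thus ?thesis using sum_emeasure[of "\<lambda>Q. Q" "maximal_sets \<Gamma>" A] fin disjoint_maximal_sets[OF assms(2)]
      by (simp add: U)
  qed
  show ?thesis unfolding eq[OF assms(3)] eq[OF assms(4)] sum_distrib_left
    using sub assms(5) by (intro sum_mono) auto
qed

text \<open>Required for the exchange of integrals in \<open>carleson_sum_le\<close>; the dyadic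
  cubes are a countable cover by sets of finite measure.\<close>

lemma sigma_finite_lebesgue: "sigma_finite_measure (lebesgue :: (real^'n) measure)"
proof
  show "\<exists>A. countable A \<and> A \<subseteq> sets lebesgue \<and> \<Union>A = space (lebesgue :: (real^'n) measure) \<and> (\<forall>a\<in>A. emeasure lebesgue a \<noteq> \<infinity>)"
  proof (intro exI conjI ballI)
    show "countable (dyadic_cubes :: (real^'n) set set)" by (rule countable_dyadic_cubes)
    show "dyadic_cubes \<subseteq> sets lebesgue" by auto
    show "\<Union>dyadic_cubes = space (lebesgue :: (real^'n) measure)"
      using mem_dyadic_cube dyadic_cube_in by (simp, blast)
    show "emeasure lebesgue Q \<noteq> \<infinity>" if "Q \<in> dyadic_cubes" for Q :: "(real^'n) set"
      unfolding emeasure_dyadic[OF that] by simp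
  qed
qed

context dyadic_A1
begin

text \<open>The left side is the integral of the sum of \<open>avg Q\<close> over the cubes through
  \<open>x\<close>. These form a chain with doubling averages, all at most \<open>K * w x\<close>
  almost everywhere, so the sum is dominated by a geometric series.\<close>

lemma packing:
  assumes "finite \<Gamma>" "\<Gamma> \<subseteq> dyadic_cubes"
    and doubling: "\<And>P Q. P \<in> \<Gamma> \<Longrightarrow> Q \<in> \<Gamma> \<Longrightarrow> P \<subset> Q \<Longrightarrow> 2 * avg Q \<le> avg P"
  shows "(\<Sum>Q\<in>\<Gamma>. emeasure W Q) \<le> ennreal (2 * K) * emeasure W (\<Union>\<Gamma>)"
proof -
  have [measurable]: "Q \<in> sets lebesgue" if "Q \<in> \<Gamma>" for Q using that assms(2) by auto
  have [measurable]: "\<Union>\<Gamma> \<in> sets lebesgue" using assms(1) by (intro sets.finite_Union) auto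
  have "(\<Sum>Q\<in>\<Gamma>. emeasure W Q) = (\<Sum>Q\<in>\<Gamma>. \<integral>\<^sup>+x. ennreal (avg Q) * indicator Q x \<partial>lebesgue)"
    using assms(2) by (intro sum.cong refl) (auto simp: emeasure_W_eq_avg nn_integral_cmult_indicator)
  also have "\<dots> = (\<integral>\<^sup>+x. (\<Sum>Q\<in>\<Gamma>. ennreal (avg Q) * indicator Q x) \<partial>lebesgue)"
    by (rule nn_integral_sum[symmetric]) auto
  also have "\<dots> \<le> (\<integral>\<^sup>+x. ennreal (2 * K) * (ennreal (w x) * indicator (\<Union>\<Gamma>) x) \<partial>lebesgue)"
    using AE_avg_le
  proof (intro nn_integral_mono_AE, eventually_elim)
    case (elim x)
    define S where "S = {Q \<in> \<Gamma>. x \<in> Q}"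
    have "sum avg S \<le> 2 * (K * w x)"
    proof (rule sum_geometric_le)
      show "finite S" using assms(1) by (simp add: S_def)
      show "0 \<le> K * w x" using K_ge_1 w_nonneg[of x] by simp
      show "avg Q \<le> K * w x" if "Q \<in> S" for Q using elim that assms(2) by (auto simp: S_def)
      show "2 * avg P \<le> avg Q \<or> 2 * avg Q \<le> avg P" if "P \<in> S" "Q \<in> S" "P \<noteq> Q" for P Q
        using that dyadic_cubes_nested[of P Q x] assms(2) doubling[of P Q] doubling[of Q P]
        by (auto simp: S_def)
    qed (rule avg_nonneg)
    have "(\<Sum>Q\<in>\<Gamma>. ennreal (avg Q) * indicator Q x) = (\<Sum>Q\<in>S. ennreal (avg Q))"
      unfolding S_def using assms(1) by (intro sum.mono_neutral_cong_right) (auto simp: indicator_def)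
    also have "\<dots> = ennreal (sum avg S)" by (rule sum_ennreal) (rule avg_nonneg)
    also have "\<dots> \<le> ennreal (2 * K) * (ennreal (w x) * indicator (\<Union>\<Gamma>) x)"
    proof (cases "x \<in> \<Union>\<Gamma>")
      case True
      thus ?thesis using \<open>sum avg S \<le> 2 * (K * w x)\<close> K_ge_1 w_nonneg[of x]
        by (auto simp: mult.assoc intro!: ennreal_leI simp flip: ennreal_mult)
    next
      case False
      hence "S = {}" by (auto simp: S_def)
      thus ?thesis by simp
    qed
    finally show ?case .
  qed
  also have "\<dots> = ennreal (2 * K) * emeasure W (\<Union>\<Gamma>)"
    by (simp add: nn_integral_cmult emeasure_W)
  finally show ?thesis .
qed

end

locale dyadic_A1_pair = u: dyadic_A1 u L + v: dyadic_A1 v K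
  for u v :: "real^'n \<Rightarrow> real" and L K
begin

text \<open>
  Layer cake in the averages of \<open>u\<close>: each superlevel family is packed with respect to \<open>v\<close>, and the resulting
  integral of the dyadic maximal function of \<open>u\<close> against \<open>h\<close> is absorbed by the A1 condition.
\<close>

lemma carleson_sum_le:
  assumes [measurable]: "h \<in> borel_measurable lebesgue"
    and \<Gamma>: "finite \<Gamma>" "\<Gamma> \<subseteq> dyadic_cubes"
    and doubling: "\<And>P Q. P \<in> \<Gamma> \<Longrightarrow> Q \<in> \<Gamma> \<Longrightarrow> P \<subset> Q \<Longrightarrow> 2 * v.avg Q \<le> v.avg P"
    and \<tau>: "\<And>Q. Q \<in> \<Gamma> \<Longrightarrow> emeasure v.W Q \<le> \<tau> * emeasure (density lebesgue h) Q"
  shows "(\<Sum>Q\<in>\<Gamma>. ennreal (u.avg Q) * emeasure v.W Q)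
    \<le> ennreal (2 * K) * \<tau> * (ennreal L * (\<integral>\<^sup>+x. h x * ennreal (u x) \<partial>lebesgue))"
proof -
  note sigma_finite_lebesgue[where 'n='n]
  then interpret pair_sigma_finite lborel "lebesgue :: (real^'n) measure"
    by (intro pair_sigma_finite.intro lborel.sigma_finite_measure_axioms)
  let ?G = "\<lambda>s. {Q \<in> \<Gamma>. s < u.avg Q}"
  \<comment> \<open>The section of \<open>E\<close> at height \<open>s > 0\<close> is the union of
    the cubes with \<open>u\<close>-average above \<open>s\<close>. The section at almost every
    point \<open>x\<close> lies in the interval from 0 to \<open>L * u x\<close>. Exchanging the
    integrals passes from the first description to the second.\<close>
  define E where "E = (\<Union>Q\<in>\<Gamma>. {0<..<u.avg Q} \<times> Q)"
  have [measurable]: "Q \<in> sets lebesgue" if "Q \<in> \<Gamma>" for Q using that \<Gamma>(2) by auto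
  have E[measurable]: "E \<in> sets (lborel \<Otimes>\<^sub>M lebesgue)"
    unfolding E_def using \<Gamma>(1) by (intro sets.finite_UN pair_measureI) auto
  have "(\<Sum>Q\<in>\<Gamma>. ennreal (u.avg Q) * emeasure v.W Q)
      = (\<Sum>Q\<in>\<Gamma>. \<integral>\<^sup>+s. indicator {0<..<u.avg Q} s * emeasure v.W Q \<partial>lborel)"
    by (intro sum.cong refl) (simp add: nn_integral_multc u.avg_nonneg)
  also have "\<dots> = (\<integral>\<^sup>+s. (\<Sum>Q\<in>\<Gamma>. indicator {0<..<u.avg Q} s * emeasure v.W Q) \<partial>lborel)"
    by (rule nn_integral_sum[symmetric]) auto
  also have "\<dots> \<le> (\<integral>\<^sup>+s. ennreal (2 * K) * \<tau> * (\<integral>\<^sup>+x. h x * indicator E (s, x) \<partial>lebesgue) \<partial>lborel)"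
  proof (rule nn_integral_mono)
    fix s :: real
    show "(\<Sum>Q\<in>\<Gamma>. indicator {0<..<u.avg Q} s * emeasure v.W Q)
      \<le> ennreal (2 * K) * \<tau> * (\<integral>\<^sup>+x. h x * indicator E (s, x) \<partial>lebesgue)"
    proof (cases "0 < s")
      case True
      have G: "finite (?G s)" "?G s \<subseteq> dyadic_cubes" using \<Gamma> by auto
      have [measurable]: "\<Union>(?G s) \<in> sets lebesgue" using G by (intro sets.finite_Union) auto
      have "(\<Sum>Q\<in>\<Gamma>. indicator {0<..<u.avg Q} s * emeasure v.W Q) = (\<Sum>Q\<in>?G s. emeasure v.W Q)"
        using \<Gamma>(1) True by (intro sum.mono_neutral_cong_right) (auto simp: indicator_def)
      also have "\<dots> \<le> ennreal (2 * K) * emeasure v.W (\<Union>(?G s))"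
        by (rule v.packing[OF G]) (use doubling in auto)
      also have "\<dots> \<le> ennreal (2 * K) * (\<tau> * emeasure (density lebesgue h) (\<Union>(?G s)))"
        by (intro mult_left_mono emeasure_Union_le G) (use \<tau> in auto)
      also have "emeasure (density lebesgue h) (\<Union>(?G s)) = (\<integral>\<^sup>+x. h x * indicator (\<Union>(?G s)) x \<partial>lebesgue)"
        by (rule emeasure_density) auto
      also have "\<dots> = (\<integral>\<^sup>+x. h x * indicator E (s, x) \<partial>lebesgue)"
        using True by (intro nn_integral_cong arg_cong2[where f="(*)"] refl) (auto simp: indicator_def E_def)
      finally show ?thesis by (simp add: mult.assoc)
    qed (simp add: indicator_def)
  qed
  also have "\<dots> = ennreal (2 * K) * \<tau> * (\<integral>\<^sup>+s. (\<integral>\<^sup>+x. h x * indicator E (s, x) \<partial>lebesgue) \<partial>lborel)"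
    by (rule nn_integral_cmult) measurable
  also have "(\<integral>\<^sup>+s. (\<integral>\<^sup>+x. h x * indicator E (s, x) \<partial>lebesgue) \<partial>lborel)
      = (\<integral>\<^sup>+x. (\<integral>\<^sup>+s. h x * indicator E (s, x) \<partial>lborel) \<partial>lebesgue)"
    using Fubini'[of "\<lambda>s x. h x * indicator E (s, x)"] by simp
  also have "\<dots> \<le> (\<integral>\<^sup>+x. ennreal L * (h x * ennreal (u x)) \<partial>lebesgue)"
    using u.AE_avg_le
  proof (intro nn_integral_mono_AE, eventually_elim)
    case (elim x)
    have "(\<integral>\<^sup>+s. h x * indicator E (s, x) \<partial>lborel) \<le> (\<integral>\<^sup>+s. h x * indicator {0<..<L * u x} s \<partial>lborel)"
    proof (intro nn_integral_mono mult_left_mono)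
      fix s
      have "s \<in> {0<..<L * u x}" if "(s, x) \<in> E"
        using that elim \<Gamma>(2) by (force simp: E_def)
      thus "indicator E (s, x) \<le> (indicator {0<..<L * u x} s :: ennreal)"
        by (auto simp: indicator_def)
    qed simp
    also have "\<dots> = ennreal L * (h x * ennreal (u x))"
      using u.w_nonneg[of x] u.K_ge_1 by (simp add: nn_integral_cmult ennreal_mult mult_ac)
    finally show ?case .
  qed
  also have "\<dots> = ennreal L * (\<integral>\<^sup>+x. h x * ennreal (u x) \<partial>lebesgue)"
    by (rule nn_integral_cmult) measurable
  finally show ?thesis by (simp add: mult_left_mono)
qed

end

section \<open>The weak-type estimate\<close>

lemma ex_powi_interval:
  fixes b y :: real
  assumes "1 < b" "0 < y"
  obtains k :: int where "b powi k < y" "y \<le> b powi (k + 1)"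
proof -
  \<comment> \<open>Ceiling minus one and not floor, because the lower bound is strict and the upper
    one is not.\<close>
  define k where "k = \<lceil>log b y\<rceil> - 1"
  have p: "b powr real_of_int j = b powi j" for j
    using assms(1) by (intro powr_real_of_int') auto
  have k: "real_of_int k < log b y" "log b y \<le> real_of_int (k + 1)" unfolding k_def by linarith+
  have "b powr real_of_int k < b powr log b y" "b powr log b y \<le> b powr real_of_int (k + 1)"
    using k assms(1) by (intro powr_less_mono powr_mono; simp)+
  hence "b powi k < y" "y \<le> b powi (k + 1)" using assms unfolding p by auto
  thus ?thesis by (rule that)
qed

lemma ex_power_interval:
  fixes B y a :: real
  assumes "1 < B" "0 < a" "a \<le> y"
  obtains i :: nat where "y / B ^ (i + 1) < a" "a \<le> y / B ^ i"
proof -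
  obtain n where "y / a < B ^ n" using real_arch_pow[OF assms(1)] by blast
  also have "\<dots> \<le> B ^ (n + 1)" using assms(1) by (intro power_increasing) auto
  finally have n: "y / B ^ (n + 1) < a" using assms by (simp add: field_simps)
  \<comment> \<open>Minimality gives the upper bound from the preceding index; at index 0 it is the
    assumption \<open>a \<le> y\<close>.\<close>
  define i where "i = (LEAST i. y / B ^ (i + 1) < a)"
  have 1: "y / B ^ (i + 1) < a" unfolding i_def using n by (rule LeastI)
  have "a \<le> y / B ^ i"
  proof (cases i)
    case (Suc m)
    hence "\<not> y / B ^ (m + 1) < a" using not_less_Least[of m "\<lambda>i. y / B ^ (i + 1) < a"] by (simp add: i_def)
    thus ?thesis using Suc by simp
  qed (use assms in simp)
  with 1 show ?thesis by (rule that)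
qed

text \<open>Subtraction of naturals truncates, so the first \<open>N\<close> terms equal 1 and an
  ordinary geometric series follows.\<close>

lemma suminf_shifted_geometric:
  fixes q :: real
  assumes "0 \<le> q" "q < 1"
  shows "(\<Sum>i. ennreal (q ^ (i - N))) = ennreal (real N + 1 / (1 - q))"
proof -
  have "(\<lambda>i. q ^ ((i + N) - N)) sums (1 / (1 - q))" using geometric_sums[of q] assms by simp
  hence "(\<lambda>i. q ^ (i - N)) sums (1 / (1 - q) + (\<Sum>i<N. q ^ (i - N)))"
    using sums_iff_shift[of "\<lambda>i. q ^ (i - N)" N "1 / (1 - q)"] by simp
  hence "(\<lambda>i. q ^ (i - N)) sums (real N + 1 / (1 - q))" by (simp add: add.commute)
  thus ?thesis using assms by (intro suminf_ennreal_eq) auto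
qed

section \<open>Stopping cubes, sorted by height and level\<close>

context dyadic_A1_pair
begin

text \<open>
  \<open>B\<close> is the loss per step in the decay estimate for \<open>u\<close>; the extra factor in \<open>b = 2 B\<close> yields the doubling
  of averages within one level, and \<open>c\<close> is the largest possible quotient of the average of \<open>v\<close> and \<open>b^k\<close>.
\<close>

definition B :: real where "B = 2 ^ (CARD('n) + 1)"

definition b :: real where "b = 2 * B"

definition c :: real where "c = b * K"

lemma constants: "1 < B" "1 < b" "0 < c" "1 \<le> c"
proof -
  show B: "1 < B" unfolding B_def by (rule one_less_power) auto
  thus "1 < b" unfolding b_def by simp
  hence "1 * 1 \<le> b * K" using v.K_ge_1 by (intro mult_mono) auto
  thus "1 \<le> c" "0 < c" unfolding c_def by auto
qed

text \<open>The Calderon-Zygmund cubes of \<open>H\<close> at height \<open>b powi k\<close>,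
  selected within a family \<open>F\<close> that is finite in all applications, so that maximal
  cubes exist.\<close>

definition stopping :: "(real^'n) measure \<Rightarrow> (real^'n) set set \<Rightarrow> int \<Rightarrow> (real^'n) set set" where
  "stopping H F k = maximal_sets {Q \<in> F. ennreal (b powi k) * emeasure lebesgue Q < emeasure H Q}"

definition level :: "nat \<Rightarrow> int \<Rightarrow> (real^'n) set \<Rightarrow> bool" where
  "level i k Q \<longleftrightarrow> c * b powi k / B ^ (i + 1) < v.avg Q \<and> v.avg Q \<le> c * b powi k / B ^ i"

text \<open>With \<open>b = 2 * B\<close>, the lower end of the window for height
  \<open>k + 1\<close> is twice the upper end of the window for height \<open>k\<close>.\<close>

lemma level_less:
  assumes "level i k P" "level i l Q" "k < l"
  shows "2 * v.avg P \<le> v.avg Q"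
proof -
  have "b * b powi k = b powi (k + 1)" using constants by (simp add: power_int_add)
  also have "\<dots> \<le> b powi l" using assms(3) constants by (intro power_int_increasing) auto
  finally have "c * (b * b powi k) / B ^ (i + 1) \<le> c * b powi l / B ^ (i + 1)"
    using constants by (intro divide_right_mono mult_left_mono) auto
  moreover have "c * (b * b powi k) / B ^ (i + 1) = 2 * (c * b powi k / B ^ i)"
    using constants(1) by (simp add: b_def)
  ultimately show ?thesis using assms(1,2) unfolding level_def by linarith
qed

lemma level_unique:
  assumes "level i k Q" "level i l Q"
  shows "k = l"
proof (rule ccontr)
  assume "k \<noteq> l"
  hence "2 * v.avg Q \<le> v.avg Q" using level_less assms by (metis linorder_neqE)
  moreover have "0 < c * b powi k / B ^ (i + 1)" using constants by simp
  ultimately show False using assms(1) unfolding level_def by linarith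
qed

definition cubes_at :: "(real^'n) measure \<Rightarrow> (real^'n) set set \<Rightarrow> nat \<Rightarrow> (real^'n) set set" where
  "cubes_at H F i = {Q. \<exists>k. Q \<in> stopping H F k \<and> level i k Q}"

text \<open>For fixed \<open>i\<close> a cube has at most one height, so sums over
  \<open>cubes_at\<close> need no second index and count no cube twice.\<close>

definition height :: "nat \<Rightarrow> (real^'n) set \<Rightarrow> int" where
  "height i Q = (THE k. level i k Q)"

lemma height_eq: "level i k Q \<Longrightarrow> height i Q = k"
  unfolding height_def using level_unique by blast

lemma cubes_atD:
  assumes "Q \<in> cubes_at H F i"
  shows "Q \<in> stopping H F (height i Q)" "level i (height i Q) Q" "Q \<in> F"
    "ennreal (b powi height i Q) * emeasure lebesgue Q \<le> emeasure H Q"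
proof -
  obtain k where k: "Q \<in> stopping H F k" "level i k Q" using assms by (auto simp: cubes_at_def)
  thus 1: "Q \<in> stopping H F (height i Q)" "level i (height i Q) Q" using height_eq[OF k(2)] by simp_all
  from 1(1) show "Q \<in> F" "ennreal (b powi height i Q) * emeasure lebesgue Q \<le> emeasure H Q"
    unfolding stopping_def using maximal_sets_subset by (blast intro: less_imp_le)+
qed

text \<open>On a cube of level \<open>i\<close> the height is comparable to the
  \<open>v\<close>-average, with factors \<open>B ^ (i + 1) / c\<close> in one direction and
  \<open>c / B ^ i\<close> in the other. The first turns the sum into one for
  \<open>carleson_sum_le\<close>, the second supplies its hypothesis. Their product is
  \<open>B\<close>, so the bound is uniform in \<open>i\<close>.\<close>

lemma sum_cubes_at_le:
  fixes i :: nat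
  assumes h: "h \<in> borel_measurable lebesgue" and F: "finite F" "F \<subseteq> dyadic_cubes"
  defines "\<Gamma> \<equiv> cubes_at (density lebesgue h) F i"
  shows "(\<Sum>Q\<in>\<Gamma>. ennreal (b powi height i Q) * emeasure u.W Q)
    \<le> ennreal (2 * B * K * L) * (\<integral>\<^sup>+x. h x * ennreal (u x) \<partial>lebesgue)" (is "_ \<le> _ * ?I")
proof -
  let ?H = "density lebesgue h"
  have D: "Q \<in> stopping ?H F (height i Q)" "level i (height i Q) Q" "Q \<in> dyadic_cubes"
    "ennreal (b powi height i Q) * emeasure lebesgue Q \<le> emeasure ?H Q" if "Q \<in> \<Gamma>" for Q
    using cubes_atD[of Q ?H F i] that F(2) unfolding \<Gamma>_def by auto
  have fin: "finite \<Gamma>" "\<Gamma> \<subseteq> dyadic_cubes"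
    using finite_subset[of \<Gamma> F] F cubes_atD(3) unfolding \<Gamma>_def by blast+
  have "ennreal (b powi height i Q) * emeasure u.W Q
      \<le> ennreal (B ^ (i + 1) / c) * (ennreal (u.avg Q) * emeasure v.W Q)" if Q: "Q \<in> \<Gamma>" for Q
  proof -
    have "c * b powi height i Q / B ^ (i + 1) \<le> v.avg Q" using D(2)[OF Q] by (simp add: level_def)
    hence "b powi height i Q \<le> B ^ (i + 1) / c * v.avg Q"
      using constants by (simp add: field_simps)
    hence "ennreal (b powi height i Q) \<le> ennreal (B ^ (i + 1) / c) * ennreal (v.avg Q)"
      using constants v.avg_nonneg by (subst ennreal_mult[symmetric]) (auto intro: ennreal_leI)
    hence "ennreal (b powi height i Q) * emeasure u.W Q
        \<le> ennreal (B ^ (i + 1) / c) * ennreal (v.avg Q) * emeasure u.W Q" by (rule mult_right_mono) simp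
    thus ?thesis
      by (simp only: u.emeasure_W_eq_avg[OF D(3)[OF Q]] v.emeasure_W_eq_avg[OF D(3)[OF Q]] mult_ac)
  qed
  hence "(\<Sum>Q\<in>\<Gamma>. ennreal (b powi height i Q) * emeasure u.W Q)
      \<le> ennreal (B ^ (i + 1) / c) * (\<Sum>Q\<in>\<Gamma>. ennreal (u.avg Q) * emeasure v.W Q)"
    unfolding sum_distrib_left by (rule sum_mono)
  also have "(\<Sum>Q\<in>\<Gamma>. ennreal (u.avg Q) * emeasure v.W Q)
      \<le> ennreal (2 * K) * ennreal (c / B ^ i) * (ennreal L * ?I)"
  proof (rule carleson_sum_le[OF h fin])
    fix P Q assume PQ: "P \<in> \<Gamma>" "Q \<in> \<Gamma>" "P \<subset> Q"
    \<comment> \<open>If the smaller cube \<open>P\<close> were not the higher one, then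
      \<open>Q\<close> would pass the stopping test at the height of \<open>P\<close>, against the
      maximality of \<open>P\<close>.\<close>
    have "height i Q < height i P"
    proof (rule ccontr)
      assume "\<not> height i Q < height i P"
      hence "b powi height i P \<le> b powi height i Q"
        using constants by (intro power_int_increasing) auto
      hence "ennreal (b powi height i P) * emeasure lebesgue Q \<le> ennreal (b powi height i Q) * emeasure lebesgue Q"
        by (intro mult_right_mono ennreal_leI) auto
      also have "\<dots> < emeasure ?H Q"
        using D(1)[OF PQ(2)] by (auto simp: stopping_def maximal_sets_def)
      finally have "Q = P"
        using D(1)[OF PQ(1)] D(1)[OF PQ(2)] PQ(3) by (auto simp: stopping_def maximal_sets_def)
      thus False using PQ(3) by blast
    qed
    thus "2 * v.avg Q \<le> v.avg P" using level_less D(2)[OF PQ(1)] D(2)[OF PQ(2)] by blast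
  next
    fix Q assume Q: "Q \<in> \<Gamma>"
    have "v.avg Q \<le> c / B ^ i * b powi height i Q" using D(2)[OF Q] by (simp add: level_def)
    hence "ennreal (v.avg Q) \<le> ennreal (c / B ^ i) * ennreal (b powi height i Q)"
      using constants by (subst ennreal_mult[symmetric]) (auto intro: ennreal_leI)
    hence "ennreal (v.avg Q) * emeasure lebesgue Q \<le> ennreal (c / B ^ i) * ennreal (b powi height i Q) * emeasure lebesgue Q"
      by (rule mult_right_mono) simp
    also have "\<dots> \<le> ennreal (c / B ^ i) * emeasure ?H Q"
      unfolding mult.assoc by (intro mult_left_mono D(4)[OF Q]) auto
    finally show "emeasure v.W Q \<le> ennreal (c / B ^ i) * emeasure ?H Q"
      by (simp only: v.emeasure_W_eq_avg[OF D(3)[OF Q]])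
  qed
  finally have "(\<Sum>Q\<in>\<Gamma>. ennreal (b powi height i Q) * emeasure u.W Q)
      \<le> ennreal (B ^ (i + 1) / c) * (ennreal (2 * K) * ennreal (c / B ^ i) * (ennreal L * ?I))"
    by (simp add: mult_left_mono)
  also have "\<dots> = (ennreal (B ^ (i + 1) / c) * (ennreal (2 * K) * ennreal (c / B ^ i)) * ennreal L) * ?I"
    by (simp only: mult.assoc)
  also have "ennreal (B ^ (i + 1) / c) * (ennreal (2 * K) * ennreal (c / B ^ i)) * ennreal L
      = ennreal (B ^ (i + 1) / c * (2 * K * (c / B ^ i)) * L)"
  proof -
    have "0 \<le> B ^ (i + 1) / c" "0 \<le> 2 * K" "0 \<le> c / B ^ i" "0 \<le> L"
      using constants u.K_ge_1 v.K_ge_1 by auto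
    thus ?thesis by (simp only: ennreal_mult mult_nonneg_nonneg)
  qed
  also have "B ^ (i + 1) / c * (2 * K * (c / B ^ i)) * L = 2 * B * K * L"
    using constants by simp
  finally show ?thesis .
qed

text \<open>By Chebyshev's inequality for \<open>v\<close>, the set \<open>A\<close> has density at
  most \<open>c / B ^ i\<close> in \<open>Q\<close>. Each decay step for \<open>u\<close> consumes a
  factor \<open>B\<close>; \<open>N\<close> steps are given up to absorb the constant
  \<open>2 * c\<close>, and \<open>i - N\<close> remain.\<close>

lemma decay_cubes_at:
  assumes Q: "Q \<in> cubes_at H F i" "Q \<in> dyadic_cubes"
  defines "A \<equiv> {x \<in> Q. b powi height i Q < v x}"
  shows "emeasure u.W A \<le> ennreal (u.\<theta> ^ (i - nat \<lceil>2 * c\<rceil>)) * emeasure u.W Q"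
proof -
  define N where "N = nat \<lceil>2 * c\<rceil>"
  define k where "k = height i Q"
  have bk: "0 < b powi k" using constants(2) by (intro zero_less_power_int) simp
  \<comment> \<open>A logarithm of \<open>2 * c\<close> would also serve. The linear choice keeps
    the bound elementary and causes the term of order \<open>K\<close> in the sum over
    \<open>i\<close>.\<close>
  have "2 * c \<le> real N" unfolding N_def by linarith
  also have "real N \<le> 2 ^ N" by (rule less_imp_le[OF of_nat_less_two_power])
  also have "\<dots> \<le> B ^ N"
    using power_increasing[of 1 "CARD('n) + 1" "2::real"] by (intro power_mono) (auto simp: B_def)
  finally have N: "2 * c \<le> B ^ N" .
  have Qs: "Q \<in> sets lebesgue" using Q(2) by simp
  have As[measurable]: "A \<in> sets lebesgue"
  proof -
    have "{x \<in> space lebesgue. b powi height i Q < v x} \<in> sets lebesgue" by measurable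
    hence "Q \<inter> {x \<in> space lebesgue. b powi height i Q < v x} \<in> sets lebesgue" using Qs by (intro sets.Int)
    moreover have "Q \<inter> {x \<in> space lebesgue. b powi height i Q < v x} = A" by (auto simp: A_def)
    ultimately show ?thesis by simp
  qed
  have AQ: "A \<subseteq> Q" by (auto simp: A_def)
  show ?thesis
  proof (cases "i \<le> N")
    case True
    hence "i - N = 0" by simp
    moreover have "emeasure u.W A \<le> emeasure u.W Q" using AQ Qs by (intro emeasure_mono) auto
    ultimately show ?thesis unfolding N_def[symmetric] by simp
  next
    case False
    have "ennreal (b powi k) * emeasure lebesgue A = (\<integral>\<^sup>+x. ennreal (b powi k) * indicator A x \<partial>lebesgue)"
      by (rule nn_integral_cmult_indicator[symmetric]) (rule As)
    also have "\<dots> \<le> (\<integral>\<^sup>+x. ennreal (v x) * indicator Q x \<partial>lebesgue)"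
      by (intro nn_integral_mono) (auto simp: A_def k_def indicator_def intro!: ennreal_leI)
    also have "\<dots> = ennreal (v.avg Q) * emeasure lebesgue Q"
      by (simp only: v.emeasure_W[OF Qs, symmetric] v.emeasure_W_eq_avg[OF Q(2)])
    also have "\<dots> \<le> ennreal (b powi k * (c / B ^ i)) * emeasure lebesgue Q"
      using cubes_atD(2)[OF Q(1)] by (intro mult_right_mono ennreal_leI) (auto simp: level_def k_def mult.commute)
    also have "\<dots> = ennreal (b powi k) * (ennreal (c / B ^ i) * emeasure lebesgue Q)"
      using bk constants by (subst ennreal_mult) (auto simp: mult.assoc)
    finally have A_le: "emeasure lebesgue A \<le> ennreal (c / B ^ i) * emeasure lebesgue Q"
    proof (subst (asm) ennreal_mult_le_mult_iff)
      show "ennreal (b powi k) \<noteq> 0" using bk by (metis ennreal_eq_0_iff not_le)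
    qed auto
    have "(2::ennreal) * 2 ^ ((i - N) * (CARD('n) + 1)) = ennreal (2 * B ^ (i - N))"
      by (simp add: ennreal_mult B_def power_mult[symmetric] mult.commute[of "i - N"] power_add flip: ennreal_power)
    hence "2 * 2 ^ ((i - N) * (CARD('n) + 1)) * emeasure lebesgue A
        \<le> ennreal (2 * B ^ (i - N)) * (ennreal (c / B ^ i) * emeasure lebesgue Q)"
      using mult_left_mono[OF A_le, of "ennreal (2 * B ^ (i - N))"] by (simp only: zero_le)
    also have "\<dots> = ennreal (2 * B ^ (i - N) * (c / B ^ i)) * emeasure lebesgue Q"
      using constants by (subst ennreal_mult) (auto simp: mult.assoc)
    also have "2 * B ^ (i - N) * (c / B ^ i) = 2 * c / B ^ N"
    proof -
      have "B ^ i = B ^ (i - N) * B ^ N" using False by (simp flip: power_add)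
      thus ?thesis using constants by simp
    qed
    also have "ennreal (2 * c / B ^ N) * emeasure lebesgue Q \<le> 1 * emeasure lebesgue Q"
      using N constants by (intro mult_right_mono) auto
    finally show ?thesis unfolding N_def[symmetric] by (intro u.decay As AQ Q(2)) simp
  qed
qed

lemma AE_stopping:
  assumes F: "finite F" "F \<subseteq> dyadic_cubes"
  shows "AE x in lebesgue. 0 < v x \<longrightarrow> (\<exists>Q\<in>F. x \<in> Q \<and> ennreal (v x) * emeasure lebesgue Q < emeasure H Q)
    \<longrightarrow> (\<exists>i. \<exists>Q\<in>cubes_at H F i. x \<in> Q \<and> b powi height i Q < v x \<and> v x \<le> b * b powi height i Q)"
proof -
  \<comment> \<open>A cube of average zero meets the set where \<open>v\<close> is positive only in
    a null set. Positivity of the average is needed to assign a level.\<close>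
  have "AE x in lebesgue. \<forall>Q\<in>F. x \<in> Q \<longrightarrow> 0 < v x \<longrightarrow> 0 < v.avg Q"
  proof (subst AE_finite_all[OF F(1)], intro ballI)
    fix Q assume "Q \<in> F"
    hence Q: "Q \<in> dyadic_cubes" using F by blast
    have Qs[measurable]: "Q \<in> sets lebesgue" using Q by simp
    show "AE x in lebesgue. x \<in> Q \<longrightarrow> 0 < v x \<longrightarrow> 0 < v.avg Q"
    proof (cases "v.avg Q = 0")
      case True
      hence "(\<integral>\<^sup>+x. ennreal (v x) * indicator Q x \<partial>lebesgue) = 0"
        using v.emeasure_W_eq_avg[OF Q] by (simp add: v.emeasure_W[OF Qs])
      hence "AE x in lebesgue. ennreal (v x) * indicator Q x = 0"
        by (subst (asm) nn_integral_0_iff_AE) auto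
      thus ?thesis by eventually_elim (auto simp: indicator_def)
    next
      case False
      hence "0 < v.avg Q" using v.avg_nonneg[of Q] by simp
      thus ?thesis by simp
    qed
  qed
  with v.AE_avg_le show ?thesis
  proof eventually_elim
    case (elim x)
    show ?case
    proof (intro impI)
      assume pos: "0 < v x" and ex: "\<exists>Q\<in>F. x \<in> Q \<and> ennreal (v x) * emeasure lebesgue Q < emeasure H Q"
      obtain P where P: "P \<in> F" "x \<in> P" "ennreal (v x) * emeasure lebesgue P < emeasure H P" using ex by blast
      obtain k where k: "b powi k < v x" "v x \<le> b powi (k + 1)"
        using ex_powi_interval[OF constants(2) pos] by blast
      let ?S = "{Q \<in> F. ennreal (b powi k) * emeasure lebesgue Q < emeasure H Q}"
      \<comment> \<open>Replacing \<open>v x\<close> by the smaller \<open>b powi k\<close>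
        preserves the strict inequality, so \<open>P\<close> competes for the maximal cubes at
        height \<open>k\<close>.\<close>
      have "ennreal (b powi k) * emeasure lebesgue P \<le> ennreal (v x) * emeasure lebesgue P"
        using k(1) by (intro mult_right_mono ennreal_leI) auto
      hence "P \<in> ?S" using P by auto
      then obtain Q where Q: "Q \<in> stopping H F k" "P \<subseteq> Q"
        unfolding stopping_def using ex_maximal_set[of ?S P] F(1) by auto
      have QF: "Q \<in> F" using Q(1) by (auto simp: stopping_def maximal_sets_def)
      have xQ: "x \<in> Q" using P Q by blast
      \<comment> \<open>The A1 condition at \<open>x\<close> puts the average below
        \<open>c * b powi k\<close>, the top of level 0, so some level \<open>i\<close> contains
        it.\<close>
      have "v.avg Q \<le> K * v x" using elim(1) QF F xQ by blast
      also have "\<dots> \<le> K * b powi (k + 1)" using k(2) v.K_ge_1 by (intro mult_left_mono) auto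
      also have "\<dots> = c * b powi k" using constants by (simp add: c_def power_int_add)
      finally obtain i where i: "c * b powi k / B ^ (i + 1) < v.avg Q" "v.avg Q \<le> c * b powi k / B ^ i"
        using ex_power_interval[OF constants(1)] elim(2) QF xQ pos by blast
      hence lev: "level i k Q" by (simp add: level_def)
      hence "Q \<in> cubes_at H F i" using Q(1) by (auto simp: cubes_at_def)
      thus "\<exists>i. \<exists>Q\<in>cubes_at H F i. x \<in> Q \<and> b powi height i Q < v x \<and> v x \<le> b * b powi height i Q"
        using xQ k height_eq[OF lev] constants
        by (intro exI[of _ i] bexI[of _ Q]) (auto simp: power_int_add mult.commute)
    qed
  qed
qed

end

section \<open>Summation over the levels and passage to all dyadic cubes\<close>

context dyadic_A1_pair
begin

text \<open>Almost every point of \<open>E\<close> lies in the part of some stopping cube where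
  \<open>v\<close> is between its height and \<open>b\<close> times that height. So the integral is
  at most \<open>b\<close> times the sum of height times the \<open>u\<close>-mass of these parts;
  decay and the uniform level estimate turn this into a geometric series in
  \<open>i\<close>.\<close>

lemma weak_type_finite:
  assumes h: "h \<in> borel_measurable lebesgue" and F: "finite F" "F \<subseteq> dyadic_cubes"
  defines "E \<equiv> {x. 0 < v x \<and> (\<exists>Q\<in>F. x \<in> Q \<and> ennreal (v x) * emeasure lebesgue Q < emeasure (density lebesgue h) Q)}"
  shows "(\<integral>\<^sup>+x. ennreal (u x * v x) * indicator E x \<partial>lebesgue)
    \<le> ennreal (2 * b * B * (3 * b + 2) * K^2 * L^2) * (\<integral>\<^sup>+x. h x * ennreal (u x) \<partial>lebesgue)" (is "_ \<le> _ * ?I")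
proof -
  let ?\<Gamma> = "cubes_at (density lebesgue h) F"
  define N where "N = nat \<lceil>2 * c\<rceil>"
  define A where "A i Q = {x \<in> Q. b powi height i Q < v x}" for i Q
  have D: "Q \<in> dyadic_cubes" if "Q \<in> ?\<Gamma> i" for Q i using cubes_atD(3) that F by blast
  have fin: "finite (?\<Gamma> i)" for i
    by (rule finite_subset[OF _ F(1)]) (use cubes_atD(3) in blast)
  have As: "A i Q \<in> sets lebesgue" if "Q \<in> ?\<Gamma> i" for i Q
  proof -
    have "{x \<in> space lebesgue. b powi height i Q < v x} \<in> sets lebesgue" by measurable
    hence "Q \<inter> {x \<in> space lebesgue. b powi height i Q < v x} \<in> sets lebesgue"
      using D[OF that] by (intro sets.Int) auto
    moreover have "Q \<inter> {x \<in> space lebesgue. b powi height i Q < v x} = A i Q" by (auto simp: A_def)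
    ultimately show ?thesis by simp
  qed
  let ?t = "\<lambda>i Q x. ennreal (b * b powi height i Q) * (ennreal (u x) * indicator (A i Q) x)"
  have meas: "?t i Q \<in> borel_measurable lebesgue" if "Q \<in> ?\<Gamma> i" for i Q
    using As[OF that] by measurable
  have "(\<integral>\<^sup>+x. ennreal (u x * v x) * indicator E x \<partial>lebesgue) \<le> (\<integral>\<^sup>+x. (\<Sum>i. \<Sum>Q\<in>?\<Gamma> i. ?t i Q x) \<partial>lebesgue)"
    using AE_stopping[OF F, of "density lebesgue h"]
  proof (intro nn_integral_mono_AE, eventually_elim)
    case (elim x)
    show ?case
    proof (cases "x \<in> E")
      case True
      then obtain i Q where Q: "Q \<in> ?\<Gamma> i" "x \<in> Q" "b powi height i Q < v x" "v x \<le> b * b powi height i Q"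
        using elim by (auto simp: E_def)
      have "ennreal (u x * v x) * indicator E x \<le> ?t i Q x"
      proof -
        have "x \<in> A i Q" using Q by (simp add: A_def)
        moreover have "ennreal (u x * v x) \<le> ennreal (b * b powi height i Q * u x)"
          using Q(4) u.w_nonneg[of x] by (intro ennreal_leI) (metis mult.commute mult_left_mono)
        moreover have "\<dots> = ennreal (b * b powi height i Q) * ennreal (u x)"
          using constants u.w_nonneg[of x] by (intro ennreal_mult) auto
        ultimately show ?thesis using True by simp
      qed
      also have "\<dots> \<le> (\<Sum>Q\<in>?\<Gamma> i. ?t i Q x)" by (rule member_le_sum[OF Q(1)]) (auto simp: fin)
      also have "\<dots> \<le> (\<Sum>i. \<Sum>Q\<in>?\<Gamma> i. ?t i Q x)"
        using sum_le_suminf[of "\<lambda>i. \<Sum>Q\<in>?\<Gamma> i. ?t i Q x" "{i}"] by simp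
      finally show ?thesis .
    qed simp
  qed
  also have "\<dots> = (\<Sum>i. \<Sum>Q\<in>?\<Gamma> i. \<integral>\<^sup>+x. ?t i Q x \<partial>lebesgue)"
    using meas by (subst nn_integral_suminf) (auto intro!: suminf_cong nn_integral_sum)
  also have "\<dots> = (\<Sum>i. \<Sum>Q\<in>?\<Gamma> i. ennreal (b * b powi height i Q) * emeasure u.W (A i Q))"
    using As by (intro suminf_cong sum.cong refl) (subst nn_integral_cmult; simp add: u.emeasure_W)
  also have "\<dots> \<le> (\<Sum>i. ennreal (u.\<theta> ^ (i - N)) * (ennreal b * (ennreal (2 * B * K * L) * ?I)))"
  proof (intro suminf_le summableI)
    fix i
    have "(\<Sum>Q\<in>?\<Gamma> i. ennreal (b * b powi height i Q) * emeasure u.W (A i Q))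
        \<le> (\<Sum>Q\<in>?\<Gamma> i. ennreal (u.\<theta> ^ (i - N)) * (ennreal b * (ennreal (b powi height i Q) * emeasure u.W Q)))"
    proof (rule sum_mono)
      fix Q assume Q: "Q \<in> ?\<Gamma> i"
      have eq: "ennreal (b * b powi height i Q) = ennreal b * ennreal (b powi height i Q)"
        using constants by (intro ennreal_mult) auto
      have "ennreal (b * b powi height i Q) * emeasure u.W (A i Q)
          \<le> ennreal (b * b powi height i Q) * (ennreal (u.\<theta> ^ (i - N)) * emeasure u.W Q)"
        unfolding N_def A_def by (intro mult_left_mono decay_cubes_at[OF Q D[OF Q]]) simp
      thus "ennreal (b * b powi height i Q) * emeasure u.W (A i Q)
          \<le> ennreal (u.\<theta> ^ (i - N)) * (ennreal b * (ennreal (b powi height i Q) * emeasure u.W Q))"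
        unfolding eq by (simp only: mult_ac)
    qed
    also have "\<dots> = ennreal (u.\<theta> ^ (i - N)) * (ennreal b * (\<Sum>Q\<in>?\<Gamma> i. ennreal (b powi height i Q) * emeasure u.W Q))"
      by (simp only: sum_distrib_left)
    also have "\<dots> \<le> ennreal (u.\<theta> ^ (i - N)) * (ennreal b * (ennreal (2 * B * K * L) * ?I))"
      by (intro mult_left_mono sum_cubes_at_le h F) auto
    finally show "(\<Sum>Q\<in>?\<Gamma> i. ennreal (b * b powi height i Q) * emeasure u.W (A i Q))
        \<le> ennreal (u.\<theta> ^ (i - N)) * (ennreal b * (ennreal (2 * B * K * L) * ?I))" .
  qed
  also have "\<dots> = (\<Sum>i. ennreal (u.\<theta> ^ (i - N))) * (ennreal b * (ennreal (2 * B * K * L) * ?I))"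
    by (rule ennreal_suminf_multc)
  also have "(\<Sum>i. ennreal (u.\<theta> ^ (i - N))) = ennreal (real N + 1 / (1 - u.\<theta>))"
    by (rule suminf_shifted_geometric) (rule u.\<theta>_bounds)+
  also have "1 / (1 - u.\<theta>) = 2 * L" by (simp add: u.\<theta>_def)
  also have "ennreal (real N + 2 * L) * (ennreal b * (ennreal (2 * B * K * L) * ?I))
      = ennreal ((real N + 2 * L) * (b * (2 * B * K * L))) * ?I"
  proof -
    have "0 \<le> real N + 2 * L" "0 \<le> b" "0 \<le> 2 * B * K * L"
      using constants u.K_ge_1 v.K_ge_1 by auto
    thus ?thesis by (simp only: ennreal_mult mult_nonneg_nonneg mult.assoc)
  qed
  also have "\<dots> \<le> ennreal (2 * b * B * (3 * b + 2) * K^2 * L^2) * ?I"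
  proof (intro mult_right_mono ennreal_leI)
    have KL: "1 \<le> K" "1 \<le> L" by (rule u.K_ge_1 v.K_ge_1)+
    \<comment> \<open>Rounding \<open>2 * c\<close> up adds at most 1, and
      \<open>1 \<le> c\<close>.\<close>
    have "real N \<le> 3 * c" using constants(4) unfolding N_def by linarith
    also have "\<dots> = 3 * b * K" by (simp add: c_def)
    also have "\<dots> \<le> 3 * b * (K * L)"
      using KL constants by (intro mult_left_mono) auto
    finally have N_le: "real N \<le> 3 * b * (K * L)" .
    have "real N + 2 * L \<le> (3 * b + 2) * (K * L)"
    proof -
      have "1 * L \<le> K * L" using KL by (intro mult_right_mono) auto
      thus ?thesis using N_le by (simp add: distrib_right)
    qed
    hence "(real N + 2 * L) * (b * (2 * B * K * L)) \<le> ((3 * b + 2) * (K * L)) * (b * (2 * B * K * L))"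
      using KL constants by (intro mult_right_mono) auto
    also have "\<dots> = 2 * b * B * (3 * b + 2) * K^2 * L^2" by (simp add: power2_eq_square mult_ac)
    finally show "(real N + 2 * L) * (b * (2 * B * K * L)) \<le> 2 * b * B * (3 * b + 2) * K^2 * L^2" .
  qed simp
  finally show ?thesis .
qed

text \<open>The constant for finite families does not depend on the family. Exhausting the countable
  set of dyadic cubes by finite subfamilies gives an increasing sequence of sets, and continuity of
  measure from below finishes.\<close>

lemma weak_type:
  assumes h: "h \<in> borel_measurable lebesgue"
  defines "E \<equiv> {x. 0 < v x \<and> (\<exists>Q\<in>dyadic_cubes. x \<in> Q \<and> ennreal (v x) * emeasure lebesgue Q < emeasure (density lebesgue h) Q)}"
  shows "(\<integral>\<^sup>+x. ennreal (u x * v x) * indicator E x \<partial>lebesgue)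
    \<le> ennreal (2 * b * B * (3 * b + 2) * K^2 * L^2) * (\<integral>\<^sup>+x. h x * ennreal (u x) \<partial>lebesgue)" (is "_ \<le> ?R")
proof -
  define D where "D = from_nat_into (dyadic_cubes :: (real^'n) set set)"
  have ne: "(dyadic_cubes :: (real^'n) set set) \<noteq> {}" using dyadic_cube_in by blast
  have rD: "range D = dyadic_cubes" unfolding D_def by (rule range_from_nat_into[OF ne countable_dyadic_cubes])
  define E' where "E' n = {x. 0 < v x \<and> (\<exists>Q\<in>D ` {..<n}. x \<in> Q \<and> ennreal (v x) * emeasure lebesgue Q < emeasure (density lebesgue h) Q)}" for n
  have E'_sets: "E' n \<in> sets lebesgue" for n
  proof -
    have "Q \<inter> {x \<in> space lebesgue. 0 < v x \<and> ennreal (v x) * m < y} \<in> sets lebesgue" if "Q \<in> dyadic_cubes" for Q m y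
      using that by (intro sets.Int) measurable
    hence "(\<Union>Q\<in>D ` {..<n}. Q \<inter> {x \<in> space lebesgue. 0 < v x \<and> ennreal (v x) * emeasure lebesgue Q < emeasure (density lebesgue h) Q}) \<in> sets lebesgue"
      using rD by (intro sets.finite_UN finite_imageI finite_lessThan) blast
    also have "(\<Union>Q\<in>D ` {..<n}. Q \<inter> {x \<in> space lebesgue. 0 < v x \<and> ennreal (v x) * emeasure lebesgue Q < emeasure (density lebesgue h) Q}) = E' n"
      by (auto simp: E'_def)
    finally show ?thesis .
  qed
  have inc: "incseq E'" by (intro incseq_SucI) (auto simp: E'_def less_Suc_eq)
  have E: "E = (\<Union>n. E' n)"
    unfolding E_def E'_def rD[symmetric] by (auto intro: lessI)
  let ?M = "density lebesgue (\<lambda>x. ennreal (u x * v x))"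
  have uv: "(\<lambda>x. ennreal (u x * v x)) \<in> borel_measurable lebesgue" by measurable
  have "emeasure ?M (\<Union>n. E' n) = (SUP n. emeasure ?M (E' n))"
    using E'_sets inc by (intro SUP_emeasure_incseq[symmetric]) auto
  also have "\<dots> \<le> ?R"
  proof (rule SUP_least)
    fix n
    have "emeasure ?M (E' n) = (\<integral>\<^sup>+x. ennreal (u x * v x) * indicator (E' n) x \<partial>lebesgue)"
      by (rule emeasure_density[OF uv E'_sets])
    also have "\<dots> \<le> ?R" unfolding E'_def
      by (rule weak_type_finite[OF h]) (use rD in auto)
    finally show "emeasure ?M (E' n) \<le> ?R" .
  qed
  finally show ?thesis
    using emeasure_density[OF uv, of E] E'_sets unfolding E by (simp add: sets.countable_UN)
qed

end

section \<open>From the estimate for dyadic A1 pairs to the weak norm\<close>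

theorem theorem1p7:
  "\<exists>c::real. c > 0 \<and>
     (\<forall>(u :: real^'n \<Rightarrow> real) v f.
        u \<in> A1 \<longrightarrow> v \<in> A1 \<longrightarrow> f \<in> L1_space (\<lambda>x. u x * v x) \<longrightarrow>
        weak_L1_norm (\<lambda>x. u x * v x) (\<lambda>x. dyadic_maximal (\<lambda>y. f y * v y) x / ennreal (v x))
          \<le> ennreal c * A1_const u ^ 2 * A1_const v ^ 4 * L1_norm (\<lambda>x. u x * v x) f)"
proof -
  \<comment> \<open>These repeat \<open>B\<close> and the constant of \<open>weak_type\<close> in
    terms of the dimension alone, since the constant must be fixed before the weights are
    given.\<close>
  define \<beta> :: real where "\<beta> = 2 ^ (CARD('n) + 1)"
  define C where "C = 2 * (2 * \<beta>) * \<beta> * (3 * (2 * \<beta>) + 2)"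
  have "0 < C" by (simp add: C_def \<beta>_def add_pos_pos)
  moreover have "weak_L1_norm (\<lambda>x. u x * v x) (\<lambda>x. dyadic_maximal (\<lambda>y. f y * v y) x / ennreal (v x))
          \<le> ennreal C * A1_const u ^ 2 * A1_const v ^ 4 * L1_norm (\<lambda>x. u x * v x) f"
    if u: "u \<in> A1" and v: "v \<in> A1" and f: "f \<in> L1_space (\<lambda>x. u x * v x)" for u v f :: "real^'n \<Rightarrow> real"
  proof -
    let ?F = "\<lambda>x. dyadic_maximal (\<lambda>y. f y * v y) x / ennreal (v x)"
    have "ennreal t * (\<integral>\<^sup>+x\<in>{x. ?F x > ennreal t}. ennreal (u x * v x) \<partial>lebesgue)
        \<le> ennreal C * A1_const u ^ 2 * A1_const v ^ 4 * L1_norm (\<lambda>x. u x * v x) f" if t: "0 < t" for t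
    \<comment> \<open>If the product vanishes almost everywhere, so does the left side. Otherwise
      neither weight is null, and both satisfy the dyadic A1 condition with constants at least
      1.\<close>
    proof (cases "AE x in lebesgue. u x * v x = 0")
      case True
      hence "(\<integral>\<^sup>+x\<in>{x. ?F x > ennreal t}. ennreal (u x * v x) \<partial>lebesgue) = (\<integral>\<^sup>+x. 0 \<partial>(lebesgue :: (real^'n) measure))"
        by (intro nn_integral_cong_AE, eventually_elim) (simp only: ennreal_0 mult_zero_left)
      thus ?thesis by simp
    next
      case False
      have un: "\<not> (AE x in lebesgue. u x = 0)"
      proof
        assume "AE x in lebesgue. u x = 0"
        hence "AE x in lebesgue. u x * v x = 0" by eventually_elim simp
        thus False using False by blast
      qed
      have vn: "\<not> (AE x in lebesgue. v x = 0)"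
      proof
        assume "AE x in lebesgue. v x = 0"
        hence "AE x in lebesgue. u x * v x = 0" by eventually_elim simp
        thus False using False by blast
      qed
      define K L where "K = enn2real (A1_const v)" and "L = enn2real (A1_const u)"
      have KL: "A1_const v = ennreal K" "A1_const u = ennreal L"
        using u v by (auto simp: A1_def K_def L_def)
      interpret dyadic_A1_pair u v L K
        unfolding K_def L_def using A1_imp_dyadic_A1 u v un vn by (intro dyadic_A1_pair.intro)
      have C_eq: "C = 2 * b * B * (3 * b + 2)"
        by (simp add: C_def \<beta>_def B_def b_def)
      have [measurable]: "f \<in> borel_measurable lebesgue" using f by (simp add: L1_space_def)
      define h where "h x = ennreal (1 / t) * ennreal \<bar>f x * v x\<bar>" for x
      have h: "h \<in> borel_measurable lebesgue" unfolding h_def by measurable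
      define E where "E = {x. 0 < v x \<and> (\<exists>Q\<in>dyadic_cubes. x \<in> Q \<and> ennreal (v x) * emeasure lebesgue Q < emeasure (density lebesgue h) Q)}"
      have E: "x \<in> E" if x: "ennreal t < ?F x" and vx: "0 < v x" for x
      proof -
        have "ennreal t * ennreal (v x) < dyadic_maximal (\<lambda>y. f y * v y) x"
        proof (rule ccontr)
          assume "\<not> ?thesis"
          hence "?F x \<le> ennreal t"
            using vx by (intro divide_le_posI_ennreal) (auto simp: mult.commute not_less)
          thus False using x by simp
        qed
        then obtain Q where Q: "Q \<in> dyadic_cubes" "x \<in> Q" "ennreal t * ennreal (v x) < average Q (\<lambda>y. f y * v y)"
          unfolding dyadic_maximal_def less_SUP_iff by auto
        define G where "G = (\<integral>\<^sup>+x\<in>Q. ennreal \<bar>f x * v x\<bar> \<partial>lebesgue)"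
        have m: "0 < measure lebesgue Q" "emeasure lebesgue Q = ennreal (measure lebesgue Q)"
          by (rule measure_dyadic_pos[OF Q(1)], rule emeasure_dyadic[OF Q(1)])
        have Qs: "Q \<in> sets lebesgue" using Q(1) by simp
        have G_meas: "(\<lambda>x. ennreal \<bar>f x * v x\<bar>) \<in> borel_measurable lebesgue" by measurable
        have HQ: "emeasure (density lebesgue h) Q = ennreal (1 / t) * G"
          unfolding emeasure_density[OF h Qs] unfolding h_def G_def mult.assoc
          by (intro nn_integral_cmult borel_measurable_times_ennreal G_meas borel_measurable_indicator Qs)
        have lt: "ennreal t * ennreal (v x) * emeasure lebesgue Q < G"
        proof (rule ccontr)
          assume "\<not> ?thesis"
          hence "G / emeasure lebesgue Q \<le> ennreal t * ennreal (v x)"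
            using m by (intro divide_le_posI_ennreal) (auto simp: mult.commute not_less simp del: emeasure_completion)
          thus False using Q(3) by (simp add: average_def G_def del: emeasure_completion)
        qed
        have "ennreal (v x) * emeasure lebesgue Q < ennreal (1 / t) * G"
        proof (rule ccontr)
          assume "\<not> ?thesis"
          hence "ennreal t * (ennreal (1 / t) * G) \<le> ennreal t * (ennreal (v x) * emeasure lebesgue Q)"
            by (intro mult_left_mono) (auto simp: not_less)
          moreover have "ennreal t * (ennreal (1 / t) * G) = G"
            using t by (simp add: mult.assoc[symmetric] flip: ennreal_mult)
          ultimately show False using lt by (simp add: mult.assoc)
        qed
        thus ?thesis using Q vx by (auto simp: E_def HQ)
      qed
      have "(\<integral>\<^sup>+x\<in>{x. ?F x > ennreal t}. ennreal (u x * v x) \<partial>lebesgue)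
          \<le> (\<integral>\<^sup>+x. ennreal (u x * v x) * indicator E x \<partial>lebesgue)"
      \<comment> \<open>Where \<open>v x = 0\<close> the quotient is infinite as soon as the maximal
        function is positive, and such a point is not in \<open>E\<close>; there the density
        \<open>u x * v x\<close> is zero.\<close>
      proof (rule nn_integral_mono)
        fix x
        show "ennreal (u x * v x) * indicator {x. ?F x > ennreal t} x \<le> ennreal (u x * v x) * indicator E x"
          using E[of x] v.w_nonneg[of x] by (cases "v x = 0") (auto simp: indicator_def)
      qed
      also have "\<dots> \<le> ennreal (C * K^2 * L^2) * (\<integral>\<^sup>+x. h x * ennreal (u x) \<partial>lebesgue)"
        unfolding E_def C_eq by (rule weak_type[OF h])
      also have "(\<integral>\<^sup>+x. h x * ennreal (u x) \<partial>lebesgue) = ennreal (1 / t) * L1_norm (\<lambda>x. u x * v x) f"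
      proof -
        have "h x * ennreal (u x) = ennreal (1 / t) * ennreal (\<bar>f x\<bar> * (u x * v x))" for x
          using u.w_nonneg[of x] v.w_nonneg[of x]
          by (simp add: h_def abs_mult ennreal_mult mult_ac)
        thus ?thesis unfolding L1_norm_def by (simp add: nn_integral_cmult)
      qed
      finally have "ennreal t * (\<integral>\<^sup>+x\<in>{x. ?F x > ennreal t}. ennreal (u x * v x) \<partial>lebesgue)
          \<le> ennreal t * (ennreal (C * K^2 * L^2) * (ennreal (1 / t) * L1_norm (\<lambda>x. u x * v x) f))"
        by (rule mult_left_mono) simp
      also have "\<dots> = (ennreal t * ennreal (1 / t)) * (ennreal (C * K^2 * L^2) * L1_norm (\<lambda>x. u x * v x) f)"
        by (simp only: mult_ac)
      also have "ennreal t * ennreal (1 / t) = 1"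
        using t by (subst ennreal_mult[symmetric]) auto
      also have "1 * (ennreal (C * K^2 * L^2) * L1_norm (\<lambda>x. u x * v x) f)
          \<le> ennreal (C * L^2 * K^4) * L1_norm (\<lambda>x. u x * v x) f"
      proof -
        \<comment> \<open>The estimate obtained is quadratic in \<open>K\<close>; as
          \<open>1 \<le> K\<close>, it implies the bound with the fourth power.\<close>
        have "K^2 \<le> K^4" using v.K_ge_1 by (intro power_increasing) auto
        hence "C * K^2 * L^2 \<le> C * L^2 * K^4"
          using \<open>0 < C\<close> mult_left_mono[of "K^2" "K^4" "C * L^2"] by (simp add: mult_ac)
        thus ?thesis by (simp add: mult_right_mono ennreal_leI)
      qed
      also have "ennreal (C * L^2 * K^4) = ennreal C * A1_const u ^ 2 * A1_const v ^ 4"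
        using \<open>0 < C\<close> u.K_ge_1 v.K_ge_1 by (simp add: KL ennreal_mult ennreal_power)
      finally show ?thesis .
    qed
    thus ?thesis unfolding weak_L1_norm_def by (intro SUP_least) auto
  qed
  ultimately show ?thesis by blast
qed

end
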